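(* Let $\mathbb{K}$ be a field, let $n\ge 1$, let $Q$ be the equioriented quiver of type $\mathbb{A}_n$, and let $V$ be a nonzero finite-dimensional representation of $Q$ over $\mathbb{K}$. Let $[u,v]\mapsto d_{u,v}$ be the multiplicity function of $V$, given by the barcode decomposition $V\simeq\bigoplus_{[u,v]\in\mathbf{Bar}(V)}\mathbf{I}[u,v]^{d_{u,v}}$, and let $J$ be the (possibly empty) set of all indices $j\in\{0,\dots,n-1\}$ for which $[0,j]$ lies in $\mathbf{Bar}(V)$. Let $V^\bullet$ be the Harder-Narasimhan filtration of $V$ along the Euler stability condition. Then: 1. the length $\ell$ of $V^\bullet$ is $\ell=1+\#J$; and moreover, 2. if the elements of $J$ are $j_1<\dots<j_{\ell-1}$ and $J^*$ is the set of all intervals $[u,v]\in\mathbf{Bar}(V)$ with $u\neq 0$, then $$\frac{V^k}{V^{k-1}}=\begin{cases}\mathbf{I}[0,j_k]^{d_{0,j_k}} & \text{if } k<\ell,\\ \bigoplus_{[u,v]\in J^*}\mathbf{I}[u,v]^{d_{u,v}} & \text{if } k=\ell.\end{cases}$$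
   Context: The equioriented quiver of type $\mathbb{A}_n$ has vertices $x_0,\dots,x_{n-1}$ and edges $e_i:x_{i-1}\to x_i$ for $1\le i\le n-1$. For integers $0\le u\le v\le n-1$, the interval module $\mathbf{I}[u,v]$ is the representation with $\mathbb{K}$ at $x_i$ for $i\in[u,v]$ and $0$ at other vertices, whose edge maps are $\mathrm{id}_{\mathbb{K}}$ whenever source and target are both nonzero, and zero otherwise. Every finite-dimensional representation $V$ decomposes as $V\simeq\bigoplus_{[u,v]\in\mathbf{Bar}(V)}\mathbf{I}[u,v]^{d_{u,v}}$ for a unique finite set $\mathbf{Bar}(V)$ of intervals (the barcode) and unique multiplicities $d_{u,v}\in\mathbb{N}_{>0}$. The equality sign between a quotient representation and a direct sum of interval modules means isomorphism of representations. For a finite acyclic quiver with vertex set $Q_0$ and a function $\alpha:Q_0\to\mathbb{R}$ (a stability condition), the $\alpha$-slope of a nonzero finite-dimensional representation $V$ is $\phi_\alpha(V)=\frac{\sum_{x\in Q_0}\alpha_x\dim V_x}{\sum_{x\in Q_0}\dim V_x}$. A nonzero $V$ is $\alpha$-semistable if $\phi_\alpha(U)\le\phi_\alpha(V)$ for every nonzero subrepresentation $U\subset V$. The Harder-Narasimhan (HN) filtration of $V\neq 0$ along $\alpha$ is the unique filtration $0=V^0\subsetneq V^1\subsetneq\dots\subsetneq V^\ell=V$ by subrepresentations whose successive quotients $V^j/V^{j-1}$ are $\alpha$-semistable with strictly decreasing $\alpha$-slopes; its length is $\ell$. The Euler stability condition is $\epsilon(x):=1-\deg_{\mathrm{in}}(x)$,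 where $\deg_{\mathrm{in}}(x)$ is the number of edges with target $x$.
   Formalization: If J* is empty the claim fails (n=1, V=I[0,0] has ℓ=1, not 1+#J=2); in that case the formal theorem states instead ℓ=#J with V^k/V^{k-1}=I[0,j_k]^{d_{0,j_k}} for all 1≤k≤ℓ. For J* nonempty it is the statement as written. *)

theory Defs
  imports
    Complex_Main
    "HOL-Algebra.QuotRing"
    "Jordan_Normal_Form.Missing_VectorSpace"
    "Graph_Theory.Digraph"
begin

text \<open>
  Quivers are digraphs (\<^typ>\<open>('v, 'e) pre_digraph\<close>). A representation attaches a module record to
  each vertex and a function to each arc; only the values at \<^term>\<open>verts Q\<close> and
  \<^term>\<open>arcs Q\<close> are meaningful. Using one type \<open>'b\<close> for the elements of all vertex
  spaces is no restriction: the spaces are carriers inside \<open>'b\<close>, each with its own operations.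
\<close>

record ('v, 'e, 'k, 'b) quiver_rep =
  vspace :: "'v \<Rightarrow> ('k, 'b) module"
  emap :: "'e \<Rightarrow> 'b \<Rightarrow> 'b"

definition is_rep ::
  "('k, 'm) ring_scheme \<Rightarrow> ('v, 'e) pre_digraph \<Rightarrow> ('v, 'e, 'k, 'b) quiver_rep \<Rightarrow> bool" where
  "is_rep K Q V \<longleftrightarrow>
     (\<forall>x\<in>verts Q. vectorspace K (vspace V x)) \<and>
     (\<forall>e\<in>arcs Q. linear_map K (vspace V (tail Q e)) (vspace V (head Q e)) (emap V e))"

definition findim_rep ::
  "('k, 'm) ring_scheme \<Rightarrow> ('v, 'e) pre_digraph \<Rightarrow> ('v, 'e, 'k, 'b) quiver_rep \<Rightarrow> bool" where
  "findim_rep K Q V \<longleftrightarrow> is_rep K Q V \<and> (\<forall>x\<in>verts Q. vectorspace.fin_dim K (vspace V x))"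

definition nonzero_rep :: "('v, 'e) pre_digraph \<Rightarrow> ('v, 'e, 'k, 'b) quiver_rep \<Rightarrow> bool" where
  "nonzero_rep Q V \<longleftrightarrow> (\<exists>x\<in>verts Q. carrier (vspace V x) \<noteq> {\<zero>\<^bsub>vspace V x\<^esub>})"

definition rep_iso ::
  "('k, 'm) ring_scheme \<Rightarrow> ('v, 'e) pre_digraph \<Rightarrow>
   ('v, 'e, 'k, 'b) quiver_rep \<Rightarrow> ('v, 'e, 'k, 'c) quiver_rep \<Rightarrow> bool" where
  "rep_iso K Q V W \<longleftrightarrow>
     (\<exists>\<phi>. (\<forall>x\<in>verts Q. linear_map K (vspace V x) (vspace W x) (\<phi> x) \<and>
                        bij_betw (\<phi> x) (carrier (vspace V x)) (carrier (vspace W x))) \<and>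
          (\<forall>e\<in>arcs Q. \<forall>a\<in>carrier (vspace V (tail Q e)).
             \<phi> (head Q e) (emap V e a) = emap W e (\<phi> (tail Q e) a)))"


subsection \<open>Subrepresentations and quotients\<close>

definition subrep ::
  "('k, 'm) ring_scheme \<Rightarrow> ('v, 'e) pre_digraph \<Rightarrow> ('v \<Rightarrow> 'b set) \<Rightarrow>
   ('v, 'e, 'k, 'b) quiver_rep \<Rightarrow> bool" where
  "subrep K Q U V \<longleftrightarrow>
     (\<forall>x\<in>verts Q. VectorSpace.subspace K (U x) (vspace V x)) \<and>
     (\<forall>e\<in>arcs Q. emap V e ` U (tail Q e) \<subseteq> U (head Q e))"

definition restrict_rep ::
  "('v, 'e, 'k, 'b) quiver_rep \<Rightarrow> ('v \<Rightarrow> 'b set) \<Rightarrow> ('v, 'e, 'k, 'b) quiver_rep" where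
  "restrict_rep V U = \<lparr>vspace = (\<lambda>x. (vspace V x)\<lparr>carrier := U x\<rparr>), emap = emap V\<rparr>"

text \<open>
  The elements of a quotient are the additive cosets of \<open>N\<close>. Scalar multiplication and the induced
  edge maps are formed on cosets by taking unions, as in \<^const>\<open>rcoset_mult\<close>. The ring fields
  \<open>mult\<close> and \<open>one\<close> of a module record carry no information.
\<close>

definition quot_module :: "('k, 'b) module \<Rightarrow> 'b set \<Rightarrow> ('k, 'b set) module" where
  "quot_module M N =
     \<lparr>carrier = a_rcosets\<^bsub>M\<^esub> N, mult = undefined, one = undefined, zero = N, add = set_add M,
      smult = (\<lambda>c A. \<Union>a\<in>A. N +>\<^bsub>M\<^esub> (c \<odot>\<^bsub>M\<^esub> a))\<rparr>"

definition quot_rep ::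
  "('v, 'e) pre_digraph \<Rightarrow> ('v, 'e, 'k, 'b) quiver_rep \<Rightarrow> ('v \<Rightarrow> 'b set) \<Rightarrow>
   ('v, 'e, 'k, 'b set) quiver_rep" where
  "quot_rep Q V U =
     \<lparr>vspace = (\<lambda>x. quot_module (vspace V x) (U x)),
      emap = (\<lambda>e A. \<Union>a\<in>A. U (head Q e) +>\<^bsub>vspace V (head Q e)\<^esub> emap V e a)\<rparr>"


subsection \<open>Stability and Harder-Narasimhan filtrations\<close>

definition slope ::
  "('k, 'm) ring_scheme \<Rightarrow> ('v, 'e) pre_digraph \<Rightarrow> ('v \<Rightarrow> real) \<Rightarrow>
   ('v, 'e, 'k, 'b) quiver_rep \<Rightarrow> real" where
  "slope K Q \<alpha> V =
     (\<Sum>x\<in>verts Q. \<alpha> x * real (vectorspace.dim K (vspace V x))) /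
     (\<Sum>x\<in>verts Q. real (vectorspace.dim K (vspace V x)))"

definition semistable ::
  "('k, 'm) ring_scheme \<Rightarrow> ('v, 'e) pre_digraph \<Rightarrow> ('v \<Rightarrow> real) \<Rightarrow>
   ('v, 'e, 'k, 'b) quiver_rep \<Rightarrow> bool" where
  "semistable K Q \<alpha> V \<longleftrightarrow>
     nonzero_rep Q V \<and>
     (\<forall>U. subrep K Q U V \<and> nonzero_rep Q (restrict_rep V U) \<longrightarrow>
          slope K Q \<alpha> (restrict_rep V U) \<le> slope K Q \<alpha> V)"

definition filt_quot ::
  "('v, 'e) pre_digraph \<Rightarrow> ('v, 'e, 'k, 'b) quiver_rep \<Rightarrow> (nat \<Rightarrow> 'v \<Rightarrow> 'b set) \<Rightarrow> nat \<Rightarrow>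
   ('v, 'e, 'k, 'b set) quiver_rep" where
  "filt_quot Q V F k = quot_rep Q (restrict_rep V (F k)) (F (k - 1))"

text \<open>
  The filtration is \<open>F 0, \<dots>, F l\<close>. Families of subspaces are compared only on
  \<^term>\<open>verts Q\<close>, and the values \<open>F k\<close> with \<open>k > l\<close> are irrelevant.
\<close>

definition hn_filtration ::
  "('k, 'm) ring_scheme \<Rightarrow> ('v, 'e) pre_digraph \<Rightarrow> ('v \<Rightarrow> real) \<Rightarrow>
   ('v, 'e, 'k, 'b) quiver_rep \<Rightarrow> nat \<Rightarrow> (nat \<Rightarrow> 'v \<Rightarrow> 'b set) \<Rightarrow> bool" where
  "hn_filtration K Q \<alpha> V l F \<longleftrightarrow>
     (\<forall>k\<in>{0..l}. subrep K Q (F k) V) \<and>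
     (\<forall>x\<in>verts Q. F 0 x = {\<zero>\<^bsub>vspace V x\<^esub>} \<and> F l x = carrier (vspace V x)) \<and>
     (\<forall>k\<in>{1..l}. (\<forall>x\<in>verts Q. F (k - 1) x \<subseteq> F k x) \<and> (\<exists>x\<in>verts Q. F (k - 1) x \<noteq> F k x)) \<and>
     (\<forall>k\<in>{1..l}. semistable K Q \<alpha> (filt_quot Q V F k)) \<and>
     (\<forall>k\<in>{1..<l}. slope K Q \<alpha> (filt_quot Q V F k) > slope K Q \<alpha> (filt_quot Q V F (k + 1)))"

definition euler_stability :: "('v, 'e) pre_digraph \<Rightarrow> 'v \<Rightarrow> real" where
  "euler_stability Q x = 1 - real (in_degree Q x)"


subsection \<open>Direct sums\<close>

text \<open>The direct sum over a \<^emph>\<open>finite\<close> index set \<open>I\<close>, realised as the product.\<close>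

definition dsum_module :: "'i set \<Rightarrow> ('i \<Rightarrow> ('k, 'b) module) \<Rightarrow> ('k, 'i \<Rightarrow> 'b) module" where
  "dsum_module I M =
     \<lparr>carrier = (\<Pi>\<^sub>E i\<in>I. carrier (M i)), mult = undefined, one = undefined,
      zero = (\<lambda>i\<in>I. \<zero>\<^bsub>M i\<^esub>), add = (\<lambda>f g. \<lambda>i\<in>I. f i \<oplus>\<^bsub>M i\<^esub> g i),
      smult = (\<lambda>c f. \<lambda>i\<in>I. c \<odot>\<^bsub>M i\<^esub> f i)\<rparr>"

definition dsum_rep ::
  "'i set \<Rightarrow> ('i \<Rightarrow> ('v, 'e, 'k, 'b) quiver_rep) \<Rightarrow> ('v, 'e, 'k, 'i \<Rightarrow> 'b) quiver_rep" where
  "dsum_rep I V =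
     \<lparr>vspace = (\<lambda>x. dsum_module I (\<lambda>i. vspace (V i) x)),
      emap = (\<lambda>e f. \<lambda>i\<in>I. emap (V i) e (f i))\<rparr>"

definition pow_rep ::
  "('v, 'e, 'k, 'b) quiver_rep \<Rightarrow> nat \<Rightarrow> ('v, 'e, 'k, nat \<Rightarrow> 'b) quiver_rep" where
  "pow_rep V m = dsum_rep {0..<m} (\<lambda>_. V)"


subsection \<open>The equioriented quiver of type A and interval modules\<close>

definition A_quiver :: "nat \<Rightarrow> (nat, nat) pre_digraph" where
  "A_quiver n = \<lparr>verts = {0..<n}, arcs = {1..<n}, tail = (\<lambda>i. i - 1), head = (\<lambda>i. i)\<rparr>"

definition self_module :: "('k, 'm) ring_scheme \<Rightarrow> ('k, 'k) module" where
  "self_module K =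
     \<lparr>carrier = carrier K, mult = mult K, one = \<one>\<^bsub>K\<^esub>, zero = \<zero>\<^bsub>K\<^esub>, add = add K, smult = mult K\<rparr>"

definition interval_rep ::
  "('k, 'm) ring_scheme \<Rightarrow> nat \<Rightarrow> nat \<Rightarrow> (nat, nat, 'k, 'k) quiver_rep" where
  "interval_rep K u v =
     \<lparr>vspace = (\<lambda>i. if i \<in> {u..v} then self_module K else (self_module K)\<lparr>carrier := {\<zero>\<^bsub>K\<^esub>}\<rparr>),
      emap = (\<lambda>i a. if i - 1 \<in> {u..v} \<and> i \<in> {u..v} then a else \<zero>\<^bsub>K\<^esub>)\<rparr>"

definition interval_sum ::
  "('k, 'm) ring_scheme \<Rightarrow> (nat \<times> nat) set \<Rightarrow> (nat \<Rightarrow> nat \<Rightarrow> nat) \<Rightarrow>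
   (nat, nat, 'k, nat \<times> nat \<Rightarrow> nat \<Rightarrow> 'k) quiver_rep" where
  "interval_sum K B d = dsum_rep B (\<lambda>(u, v). pow_rep (interval_rep K u v) (d u v))"

text \<open>
  \<open>B\<close> is the barcode of \<open>V\<close> and \<open>d\<close> its multiplicity function; the values of \<open>d\<close> outside
  \<open>B\<close> are irrelevant.
\<close>

definition barcode_decomposition ::
  "('k, 'm) ring_scheme \<Rightarrow> nat \<Rightarrow> (nat, nat, 'k, 'b) quiver_rep \<Rightarrow>
   (nat \<times> nat) set \<Rightarrow> (nat \<Rightarrow> nat \<Rightarrow> nat) \<Rightarrow> bool" where
  "barcode_decomposition K n V B d \<longleftrightarrow>
     finite B \<and> (\<forall>(u, v)\<in>B. u \<le> v \<and> v \<le> n - 1 \<and> d u v > 0) \<and>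
     rep_iso K (A_quiver n) V (interval_sum K B d)"

end

theory Submission
  imports Defs
begin

text \<open>
  Write \<open>A U\<close> for the sum of \<open>\<alpha> x * dim (U x)\<close> over the vertices (\<open>weight\<close>) and \<open>D U\<close> for the sum of the
  \<open>dim (U x)\<close> (\<open>total_dim\<close>). A Harder-Narasimhan filtration \<open>F\<close> with slopes \<open>\<mu>\<close> is recovered from the
  functions \<open>U \<mapsto> A U - t * D U\<close> on subrepresentations, \<open>t\<close> real. To see this, cut \<open>U\<close> along \<open>F\<close>. The
  piece of \<open>U\<close> in a successive quotient is a subrepresentation of it, so by semistability it contributes at
  most \<open>(\<mu> i - t)\<close> times its dimension. Keeping the whole quotient where \<open>\<mu> i > t\<close> and nothing where
  \<open>\<mu> i < t\<close> is therefore best possible, and it is the only optimal choice: the term \<open>F k\<close> that separates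
  the slopes above \<open>t\<close> from those below is the unique maximiser (\<open>slope_filtration_maximises\<close>).

  This argument uses only inequalities between dimensions of intersections of \<open>U\<close> with the terms of the
  chain. A chain that satisfies them is called a \<open>slope_filtration\<close> below. Every Harder-Narasimhan
  filtration is one (\<open>hn_filtration_imp_slope_filtration\<close>), and two of them with the same \<open>\<alpha>\<close> agree
  (\<open>slope_filtration_unique\<close>), because each term of either is the maximiser for some \<open>t\<close> that avoids all
  slopes. So it suffices to exhibit one \<open>slope_filtration\<close> and to compute its quotients.

  For the Euler stability condition on the equioriented quiver, \<open>A U\<close> is just \<open>dim (U 0)\<close>. Let
  \<open>j\<^sub>1 < j\<^sub>2 < \<dots>\<close> be the right ends of the bars \<open>[0, j]\<close>. The chain adds the summands
  \<open>I[0, j\<^sub>1]\<close>, \<open>I[0, j\<^sub>2]\<close>, and so on with their multiplicities, and finally the bars that do not start at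
  \<open>0\<close>, if there are any. In the quotient \<open>I[0, j]\<^sup>d\<close> the edge maps before \<open>j\<close> are injective, so the dimensions of a
  subrepresentation cannot decrease from \<open>0\<close> to \<open>j\<close>; its dimension at \<open>0\<close> is at most \<open>1 / (j + 1)\<close> of the
  total, with equality for \<open>I[0, j]\<^sup>d\<close> itself. The last quotient vanishes at \<open>0\<close> and has slope \<open>0\<close>. The
  slopes \<open>1 / (j\<^sub>1 + 1) > 1 / (j\<^sub>2 + 1) > \<dots> > 0\<close> decrease strictly, as required.
\<close>

section \<open>Linear maps, subspaces and quotients\<close>

text \<open>
  The vector space axioms pass along a surjection that respects the operations. The quotient modules, whose
  operations are defined on cosets, are seen to be vector spaces in this way.
\<close>

lemma linear_map_onto_image:
  assumes M: "vectorspace K M"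
    and im: "f ` carrier M = carrier W"
    and add: "\<And>a b. a \<in> carrier M \<Longrightarrow> b \<in> carrier M \<Longrightarrow> f (a \<oplus>\<^bsub>M\<^esub> b) = f a \<oplus>\<^bsub>W\<^esub> f b"
    and smult: "\<And>c a. c \<in> carrier K \<Longrightarrow> a \<in> carrier M \<Longrightarrow> f (c \<odot>\<^bsub>M\<^esub> a) = c \<odot>\<^bsub>W\<^esub> f a"
    and zero: "f \<zero>\<^bsub>M\<^esub> = \<zero>\<^bsub>W\<^esub>"
  shows "linear_map K M W f"
proof -
  interpret M: vectorspace K M by (rule M)
  have cl: "f a \<in> carrier W" if "a \<in> carrier M" for a
    using that unfolding im[symmetric] by blast
  have "vectorspace K W"
  proof (rule vs_criteria, unfold im[symmetric], goal_cases)
    case 1 show ?case by (rule M.field.field_axioms)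
  next
    case 2 show ?case unfolding zero[symmetric] by simp
  next
    case 3 show ?case by (auto simp: add[symmetric])
  next
    case 4
    have "f a \<oplus>\<^bsub>W\<^esub> f (\<ominus>\<^bsub>M\<^esub> a) = \<zero>\<^bsub>W\<^esub>" if "a \<in> carrier M" for a
      using add[of a "\<ominus>\<^bsub>M\<^esub> a"] that zero by (simp add: M.M.r_neg)
    then show ?case using M.M.a_inv_closed by (blast intro: imageI)
  next
    case 5 show ?case by (auto simp: smult[symmetric])
  next
    case 6 show ?case by (auto simp: add[symmetric] M.M.a_comm)
  next
    case 7 show ?case by (auto simp: add[symmetric] M.M.a_assoc)
  next
    case 8 show ?case unfolding zero[symmetric] by (auto simp: add[symmetric])
  next
    case 9 show ?case by (auto simp: smult[symmetric] M.smult_assoc1)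
  next
    case 10 show ?case by (auto simp: smult[symmetric])
  next
    case 11 show ?case by (auto simp: smult[symmetric] add[symmetric] M.smult_l_distr)
  next
    case 12 show ?case by (auto simp: smult[symmetric] add[symmetric] M.smult_r_distr)
  qed
  then show ?thesis
    using M add smult cl
    by (simp add: linear_map_def mod_hom_def mod_hom_axioms_def vectorspace_def LinearCombinations.module_hom_def)
qed

lemma subspace_iff:
  assumes "vectorspace K M"
  shows "VectorSpace.subspace K U M \<longleftrightarrow> U \<subseteq> carrier M \<and> \<zero>\<^bsub>M\<^esub> \<in> U \<and>
    (\<forall>a\<in>U. \<forall>b\<in>U. a \<oplus>\<^bsub>M\<^esub> b \<in> U) \<and> (\<forall>c\<in>carrier K. \<forall>a\<in>U. c \<odot>\<^bsub>M\<^esub> a \<in> U)"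
  using assms by (auto simp: VectorSpace.subspace_def submodule_def vectorspace_def)

lemma subspace_zero: "vectorspace K M \<Longrightarrow> VectorSpace.subspace K {\<zero>\<^bsub>M\<^esub>} M"
proof -
  assume a: "vectorspace K M"
  interpret vectorspace K M by fact
  show ?thesis using subspace_iff[OF a] by auto
qed

lemma subspace_inter: "VectorSpace.subspace K A M \<Longrightarrow> VectorSpace.subspace K B M \<Longrightarrow> VectorSpace.subspace K (A \<inter> B) M"
  by (auto simp: VectorSpace.subspace_def submodule_def)

lemma subspace_of_subspace:
  assumes "VectorSpace.subspace K A M" "VectorSpace.subspace K B M" "B \<subseteq> A"
  shows "VectorSpace.subspace K B (M\<lparr>carrier := A\<rparr>)"
proof -
  have M: "vectorspace K M" using assms(1) by (simp add: VectorSpace.subspace_def)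
  have "vectorspace K (M\<lparr>carrier := A\<rparr>)" using vectorspace.subspace_is_vs[OF M assms(1)] .
  from subspace_iff[OF this] subspace_iff[OF M] show ?thesis using assms by auto
qed

text \<open>
  Independent sets in a subspace are independent in the whole space, so their sizes are bounded and a
  maximal one is a finite basis.
\<close>

lemma subspace_finite_dim:
  assumes V: "vectorspace K M" "vectorspace.fin_dim K M" and S: "VectorSpace.subspace K U M"
  shows "vectorspace.fin_dim K (M\<lparr>carrier := U\<rparr>)"
    and "vectorspace.dim K (M\<lparr>carrier := U\<rparr>) \<le> vectorspace.dim K M"
    and "vectorspace.dim K (M\<lparr>carrier := U\<rparr>) = vectorspace.dim K M \<Longrightarrow> U = carrier M"
proof -
  interpret M: vectorspace K M by (rule V)
  interpret U: vectorspace K "M\<lparr>carrier := U\<rparr>" by (rule M.subspace_is_vs[OF S])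
  have sub: "submodule K U M" and UM: "U \<subseteq> carrier M"
    using S by (auto simp: VectorSpace.subspace_def submodule_def)
  have li: "U.lin_indpt A \<longleftrightarrow> M.lin_indpt A" and sp: "U.span A = M.span A" if "A \<subseteq> U" for A
    using M.span_li_not_depend[OF that sub] by auto
  have "\<exists>A. finite A \<and> maximal A (\<lambda>S. S \<subseteq> carrier (M\<lparr>carrier := U\<rparr>) \<and> U.lin_indpt S)"
  proof (rule maximal_exists[where N = M.dim and B = "{}"])
    fix A assume "A \<subseteq> carrier (M\<lparr>carrier := U\<rparr>) \<and> U.lin_indpt A"
    then have "A \<subseteq> carrier M" "M.lin_indpt A" using li UM by auto
    then show "finite A \<and> card A \<le> M.dim" using M.li_le_dim[OF V(2)] by auto
  next
    show "{} \<subseteq> carrier (M\<lparr>carrier := U\<rparr>) \<and> U.lin_indpt {}" by (auto simp: U.lin_dep_def)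
  qed
  then obtain A where A: "finite A" "U.basis A" using U.max_li_is_basis by blast
  have AU: "A \<subseteq> U" "M.lin_indpt A" and spA: "M.span A = U"
    using A li sp by (auto simp: U.basis_def)
  show fd: "U.fin_dim" using A unfolding U.fin_dim_def U.basis_def by auto
  have card: "U.dim = card A" by (rule U.dim_basis[OF A])
  then show "U.dim \<le> M.dim" using M.li_le_dim[OF V(2)] AU UM by auto
  assume "U.dim = M.dim"
  with card have "M.basis A" using M.dim_li_is_basis[OF V(2) A(1)] AU UM by auto
  then show "U = carrier M" using spA by (simp add: M.basis_def)
qed

lemma dim_zero_space: "vectorspace K M \<Longrightarrow> vectorspace.dim K (M\<lparr>carrier := {\<zero>\<^bsub>M\<^esub>}\<rparr>) = 0"
proof -
  assume M: "vectorspace K M"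
  interpret Z: vectorspace K "M\<lparr>carrier := {\<zero>\<^bsub>M\<^esub>}\<rparr>"
    using vectorspace.subspace_is_vs[OF M subspace_zero[OF M]] .
  have "Z.span {\<zero>\<^bsub>M\<^esub>} = {\<zero>\<^bsub>M\<^esub>}"
    using Z.span_is_subset2[of "{\<zero>\<^bsub>M\<^esub>}"] Z.span_zero by auto
  then show ?thesis using Z.dim0I by simp
qed

lemma subspace_dim_mono:
  assumes V: "vectorspace K M" "vectorspace.fin_dim K M"
    and S: "VectorSpace.subspace K A M" "VectorSpace.subspace K B M" "A \<subseteq> B"
  shows "vectorspace.dim K (M\<lparr>carrier := A\<rparr>) \<le> vectorspace.dim K (M\<lparr>carrier := B\<rparr>)"
    and "vectorspace.dim K (M\<lparr>carrier := A\<rparr>) = vectorspace.dim K (M\<lparr>carrier := B\<rparr>) \<Longrightarrow> A = B"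
proof -
  have B: "vectorspace K (M\<lparr>carrier := B\<rparr>)" by (rule vectorspace.subspace_is_vs[OF V(1) S(2)])
  note * = subspace_finite_dim[OF B subspace_finite_dim(1)[OF V S(2)] subspace_of_subspace[OF S(2,1,3)]]
  show "vectorspace.dim K (M\<lparr>carrier := A\<rparr>) \<le> vectorspace.dim K (M\<lparr>carrier := B\<rparr>)"
    using *(2) by simp
  show "vectorspace.dim K (M\<lparr>carrier := A\<rparr>) = vectorspace.dim K (M\<lparr>carrier := B\<rparr>) \<Longrightarrow> A = B"
    using *(3) by simp
qed

lemma linear_map_simps:
  assumes "linear_map K M W f"
  shows "a \<in> carrier M \<Longrightarrow> f a \<in> carrier W"
    and "a \<in> carrier M \<Longrightarrow> b \<in> carrier M \<Longrightarrow> f (a \<oplus>\<^bsub>M\<^esub> b) = f a \<oplus>\<^bsub>W\<^esub> f b"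
    and "c \<in> carrier K \<Longrightarrow> a \<in> carrier M \<Longrightarrow> f (c \<odot>\<^bsub>M\<^esub> a) = c \<odot>\<^bsub>W\<^esub> f a"
    and "f \<zero>\<^bsub>M\<^esub> = \<zero>\<^bsub>W\<^esub>"
    and "vectorspace K M" "vectorspace K W"
proof -
  interpret linear_map K M W f by fact
  show "a \<in> carrier M \<Longrightarrow> f a \<in> carrier W"
    "a \<in> carrier M \<Longrightarrow> b \<in> carrier M \<Longrightarrow> f (a \<oplus>\<^bsub>M\<^esub> b) = f a \<oplus>\<^bsub>W\<^esub> f b"
    "c \<in> carrier K \<Longrightarrow> a \<in> carrier M \<Longrightarrow> f (c \<odot>\<^bsub>M\<^esub> a) = c \<odot>\<^bsub>W\<^esub> f a"
    "f \<zero>\<^bsub>M\<^esub> = \<zero>\<^bsub>W\<^esub>"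
    by simp_all
  show "vectorspace K M" "vectorspace K W" by unfold_locales
qed

lemma subspace_image:
  assumes "linear_map K M W f" "VectorSpace.subspace K A M"
  shows "VectorSpace.subspace K (f ` A) W"
proof -
  note L = linear_map_simps[OF assms(1)]
  have A: "A \<subseteq> carrier M" "\<zero>\<^bsub>M\<^esub> \<in> A" "\<forall>a\<in>A. \<forall>b\<in>A. a \<oplus>\<^bsub>M\<^esub> b \<in> A"
     "\<forall>c\<in>carrier K. \<forall>a\<in>A. c \<odot>\<^bsub>M\<^esub> a \<in> A"
    using assms(2) by (auto simp add: subspace_iff[OF L(5)])
  show ?thesis unfolding subspace_iff[OF L(6)]
  proof (intro conjI ballI)
    show "f ` A \<subseteq> carrier W" using A L by auto
    show "\<zero>\<^bsub>W\<^esub> \<in> f ` A" using A L by (metis imageI)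
    fix a b assume "a \<in> f ` A" "b \<in> f ` A"
    then obtain a' b' where "a' \<in> A" "b' \<in> A" "a = f a'" "b = f b'" by auto
    then show "a \<oplus>\<^bsub>W\<^esub> b \<in> f ` A" using A L(2)[of a' b'] by (metis imageI subsetD)
  next
    fix c a assume c: "c \<in> carrier K" "a \<in> f ` A"
    then obtain a' where "a' \<in> A" "a = f a'" by auto
    then show "c \<odot>\<^bsub>W\<^esub> a \<in> f ` A" using c A L(3)[of c a'] by (metis imageI subsetD)
  qed
qed

lemma linear_map_between_subspaces:
  assumes f: "linear_map K M W f" and A: "VectorSpace.subspace K A M"
    and B: "VectorSpace.subspace K B W" and sub: "f ` A \<subseteq> B"
  shows "linear_map K (M\<lparr>carrier := A\<rparr>) (W\<lparr>carrier := B\<rparr>) f"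
proof -
  note L = linear_map_simps[OF f]
  have AM: "A \<subseteq> carrier M" using A by (simp add: subspace_iff[OF L(5)])
  have vA: "vectorspace K (M\<lparr>carrier := A\<rparr>)" and vB: "vectorspace K (W\<lparr>carrier := B\<rparr>)"
    using vectorspace.subspace_is_vs[OF L(5) A] vectorspace.subspace_is_vs[OF L(6) B] .
  have "f \<in> LinearCombinations.module_hom K (M\<lparr>carrier := A\<rparr>) (W\<lparr>carrier := B\<rparr>)"
    using AM sub L(2,3) by (auto simp: LinearCombinations.module_hom_def subset_iff)
  then show ?thesis
    using vA vB by (simp add: linear_map_def mod_hom_def mod_hom_axioms_def vectorspace_def)
qed

lemma dim_image_plus_kernel:
  assumes f: "linear_map K M W f" and fd: "vectorspace.fin_dim K M" and A: "VectorSpace.subspace K A M"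
  shows "vectorspace.dim K (W\<lparr>carrier := f ` A\<rparr>) +
      vectorspace.dim K (M\<lparr>carrier := {a \<in> A. f a = \<zero>\<^bsub>W\<^esub>}\<rparr>) =
      vectorspace.dim K (M\<lparr>carrier := A\<rparr>)"
proof -
  note L = linear_map_simps[OF f]
  interpret f: linear_map K "M\<lparr>carrier := A\<rparr>" "W\<lparr>carrier := f ` A\<rparr>" f
    by (rule linear_map_between_subspaces[OF f A subspace_image[OF f A] order_refl])
  have "f.V.fin_dim" by (rule subspace_finite_dim(1)[OF L(5) fd A])
  from f.rank_nullity[OF this] show ?thesis by (simp add: f.im_def f.ker_def)
qed

text \<open>
  These properties of the coset map are all that is used about quotient modules: the set-theoretic formulas
  for their operations are not unfolded outside this proof.
\<close>

lemma linear_coset_map: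
  assumes N: "VectorSpace.subspace K N M"
  shows "linear_map K M (quot_module M N) (\<lambda>a. N +>\<^bsub>M\<^esub> a)"
    and "(\<lambda>a. N +>\<^bsub>M\<^esub> a) ` carrier M = carrier (quot_module M N)"
    and "a \<in> carrier M \<Longrightarrow> N +>\<^bsub>M\<^esub> a = \<zero>\<^bsub>quot_module M N\<^esub> \<longleftrightarrow> a \<in> N"
    and "a \<in> carrier M \<Longrightarrow> b \<in> N +>\<^bsub>M\<^esub> a \<Longrightarrow> N +>\<^bsub>M\<^esub> b = N +>\<^bsub>M\<^esub> a"
    and "a \<in> carrier M \<Longrightarrow> a \<in> N +>\<^bsub>M\<^esub> a"
proof -
  have V: "vectorspace K M" using N by (simp add: VectorSpace.subspace_def)
  interpret M: vectorspace K M by (rule V)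
  have N': "N \<subseteq> carrier M" "\<zero>\<^bsub>M\<^esub> \<in> N" "\<forall>a\<in>N. \<forall>b\<in>N. a \<oplus>\<^bsub>M\<^esub> b \<in> N"
    "\<forall>c\<in>carrier K. \<forall>a\<in>N. c \<odot>\<^bsub>M\<^esub> a \<in> N"
    using N by (auto simp: subspace_iff[OF V])
  have neg: "\<ominus>\<^bsub>M\<^esub> a \<in> N" if "a \<in> N" for a
  proof -
    have "(\<ominus>\<^bsub>K\<^esub> \<one>\<^bsub>K\<^esub>) \<odot>\<^bsub>M\<^esub> a \<in> N" using N' that by auto
    moreover have "(\<ominus>\<^bsub>K\<^esub> \<one>\<^bsub>K\<^esub>) \<odot>\<^bsub>M\<^esub> a = \<ominus>\<^bsub>M\<^esub> a"
      by (rule M.smult_minus_1) (use N'(1) that in blast)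
    ultimately show ?thesis by simp
  qed
  have sg: "additive_subgroup N M"
    by (intro additive_subgroup.intro subgroup.intro)
      (use N' neg in \<open>auto simp: a_inv_def\<close>)
  interpret N: abelian_subgroup N M
    by (rule abelian_subgroupI3[OF sg]) unfold_locales
  show im: "(\<lambda>a. N +>\<^bsub>M\<^esub> a) ` carrier M = carrier (quot_module M N)"
    by (auto simp: quot_module_def A_RCOSETS_def')
  show mem: "N +>\<^bsub>M\<^esub> b = N +>\<^bsub>M\<^esub> a" if "a \<in> carrier M" "b \<in> N +>\<^bsub>M\<^esub> a" for a b
    using that N.a_repr_independence' by metis
  show self: "a \<in> N +>\<^bsub>M\<^esub> a" if "a \<in> carrier M" for a
    using that N.a_rcos_self by auto
  show "linear_map K M (quot_module M N) (\<lambda>a. N +>\<^bsub>M\<^esub> a)"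
  proof (rule linear_map_onto_image[OF V im])
    fix a b assume ab: "a \<in> carrier M" "b \<in> carrier M"
    then show "N +>\<^bsub>M\<^esub> (a \<oplus>\<^bsub>M\<^esub> b) = (N +>\<^bsub>M\<^esub> a) \<oplus>\<^bsub>quot_module M N\<^esub> (N +>\<^bsub>M\<^esub> b)"
      by (simp add: quot_module_def N.a_rcos_sum)
  next
    fix c a assume c: "c \<in> carrier K" and a: "a \<in> carrier M"
    \<comment> \<open>All members of the union that defines scalar multiplication are the same coset.\<close>
    have *: "N +>\<^bsub>M\<^esub> (c \<odot>\<^bsub>M\<^esub> b) = N +>\<^bsub>M\<^esub> (c \<odot>\<^bsub>M\<^esub> a)" if b: "b \<in> N +>\<^bsub>M\<^esub> a" for b
    proof -
      obtain h where h: "h \<in> N" "b = h \<oplus>\<^bsub>M\<^esub> a" using b by (auto simp: a_r_coset_def')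
      then have "c \<odot>\<^bsub>M\<^esub> b = (c \<odot>\<^bsub>M\<^esub> h) \<oplus>\<^bsub>M\<^esub> (c \<odot>\<^bsub>M\<^esub> a)"
        using M.smult_r_distr[OF c _ a, of h] N'(1) by auto
      moreover have "c \<odot>\<^bsub>M\<^esub> h \<in> N" using N'(4) c h(1) by blast
      ultimately have "c \<odot>\<^bsub>M\<^esub> b \<in> N +>\<^bsub>M\<^esub> (c \<odot>\<^bsub>M\<^esub> a)"
        unfolding a_r_coset_def' by blast
      then show ?thesis by (rule mem[OF M.smult_closed[OF c a]])
    qed
    have "N +>\<^bsub>M\<^esub> a \<noteq> {}" using self[OF a] by blast
    then have "(\<Union>b\<in>N +>\<^bsub>M\<^esub> a. N +>\<^bsub>M\<^esub> (c \<odot>\<^bsub>M\<^esub> b)) = N +>\<^bsub>M\<^esub> (c \<odot>\<^bsub>M\<^esub> a)"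
      by (rule SUP_eq_const) (rule *)
    then show "N +>\<^bsub>M\<^esub> (c \<odot>\<^bsub>M\<^esub> a) = c \<odot>\<^bsub>quot_module M N\<^esub> (N +>\<^bsub>M\<^esub> a)"
      by (simp add: quot_module_def)
  next
    show "N +>\<^bsub>M\<^esub> \<zero>\<^bsub>M\<^esub> = \<zero>\<^bsub>quot_module M N\<^esub>"
      using N' by (auto simp: quot_module_def a_r_coset_def' subset_iff)
  qed
  show "N +>\<^bsub>M\<^esub> a = \<zero>\<^bsub>quot_module M N\<^esub> \<longleftrightarrow> a \<in> N" if "a \<in> carrier M"
  proof
    assume "N +>\<^bsub>M\<^esub> a = \<zero>\<^bsub>quot_module M N\<^esub>"
    then show "a \<in> N" using self[OF that] by (simp add: quot_module_def)
  next
    assume a: "a \<in> N"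
    then show "N +>\<^bsub>M\<^esub> a = \<zero>\<^bsub>quot_module M N\<^esub>"
      using N.a_rcos_const by (simp add: quot_module_def)
  qed
qed

lemma dim_image_in_quotient:
  assumes V: "vectorspace K M" "vectorspace.fin_dim K M"
    and S: "VectorSpace.subspace K A M" "VectorSpace.subspace K N M" "VectorSpace.subspace K U M" "N \<subseteq> A" "U \<subseteq> A"
  shows "vectorspace.dim K ((quot_module (M\<lparr>carrier := A\<rparr>) N)
        \<lparr>carrier := (\<lambda>a. N +>\<^bsub>M\<lparr>carrier := A\<rparr>\<^esub> a) ` U\<rparr>) + vectorspace.dim K (M\<lparr>carrier := U \<inter> N\<rparr>) =
      vectorspace.dim K (M\<lparr>carrier := U\<rparr>)"
proof -
  let ?A = "M\<lparr>carrier := A\<rparr>"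
  note c = linear_coset_map[OF subspace_of_subspace[OF S(1,2,4)]]
  have "{a \<in> U. N +>\<^bsub>?A\<^esub> a = \<zero>\<^bsub>quot_module ?A N\<^esub>} = U \<inter> N"
    using S(5) c(3) by auto
  then show ?thesis
    using dim_image_plus_kernel[OF c(1) subspace_finite_dim(1)[OF V S(1)]
      subspace_of_subspace[OF S(1,3,5)]] by simp
qed

text \<open>
  The last hypothesis says that the kernel of \<open>A \<rightarrow> B / B'\<close> lies in \<open>A'\<close>. So \<open>A / A'\<close> is no larger than the
  image of \<open>A\<close> in \<open>B / B'\<close>. The two dimensions come from rank-nullity for \<open>f\<close> and for the coset map of \<open>B'\<close>.
\<close>

lemma codim_le_of_injective_mod:
  fixes M :: "('k, 'b) module" and M' :: "('k, 'c) module"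
  assumes f: "linear_map K M M' f" and fd: "vectorspace.fin_dim K M" "vectorspace.fin_dim K M'"
    and A: "VectorSpace.subspace K A M" "VectorSpace.subspace K A' M" "A' \<subseteq> A"
    and B: "VectorSpace.subspace K B M'" "VectorSpace.subspace K B' M'" "B' \<subseteq> B"
    and sub: "f ` A \<subseteq> B" and inj: "\<And>a. a \<in> A \<Longrightarrow> f a \<in> B' \<Longrightarrow> a \<in> A'"
  shows "vectorspace.dim K (M\<lparr>carrier := A\<rparr>) + vectorspace.dim K (M'\<lparr>carrier := B'\<rparr>) \<le>
    vectorspace.dim K (M\<lparr>carrier := A'\<rparr>) + vectorspace.dim K (M'\<lparr>carrier := B\<rparr>)"
proof -
  note L = linear_map_simps[OF f]
  have fA: "VectorSpace.subspace K (f ` A) M'" by (rule subspace_image[OF f A(1)])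
  let ?B = "M'\<lparr>carrier := B\<rparr>"
  let ?Q = "quot_module ?B B'" and ?c = "\<lambda>a. B' +>\<^bsub>?B\<^esub> a"
  let ?d = "\<lambda>M A. vectorspace.dim K (M\<lparr>carrier := A\<rparr>)"
  have vB: "vectorspace K ?B" by (rule vectorspace.subspace_is_vs[OF L(6) B(1)])
  note c = linear_coset_map[OF subspace_of_subspace[OF B]]
  have 1: "?d ?Q (?c ` f ` A) + ?d M' (f ` A \<inter> B') = ?d M' (f ` A)"
    by (rule dim_image_in_quotient[OF L(6) fd(2) B(1,2) fA B(3) sub])
  have 2: "?d ?Q (?c ` B) + ?d M' (B \<inter> B') = ?d M' B"
    by (rule dim_image_in_quotient[OF L(6) fd(2) B(1,2) B(1) B(3)]) simp
  have BB: "B \<inter> B' = B'" using B(3) by auto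
  have fdB: "vectorspace.fin_dim K ?B" by (rule subspace_finite_dim(1)[OF L(6) fd(2) B(1)])
  have fdQ: "vectorspace.fin_dim K ?Q"
    using linear_map.surj_fin_dim[OF c(1) fdB c(2)] .
  have 3: "?d ?Q (?c ` f ` A) \<le> ?d ?Q (?c ` B)"
    using sub by (intro subspace_dim_mono[OF linear_map_simps(6)[OF c(1)] fdQ]
      subspace_image[OF c(1)] subspace_of_subspace fA B image_mono) auto
  have 4: "?d M' (f ` A) + ?d M {a \<in> A. f a = \<zero>\<^bsub>M'\<^esub>} = ?d M A"
    by (rule dim_image_plus_kernel[OF f fd(1) A(1)])
  let ?P = "{a \<in> A. f a \<in> B'}"
  have P: "VectorSpace.subspace K ?P M"
    using A(1) B(2) L unfolding subspace_iff[OF L(5)] subspace_iff[OF L(6)]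
    by (auto simp: subset_iff)
  have "f ` ?P = f ` A \<inter> B'" by auto
  moreover have "{a \<in> ?P. f a = \<zero>\<^bsub>M'\<^esub>} = {a \<in> A. f a = \<zero>\<^bsub>M'\<^esub>}"
    using B(2) unfolding subspace_iff[OF L(6)] by auto
  ultimately have 5: "?d M' (f ` A \<inter> B') + ?d M {a \<in> A. f a = \<zero>\<^bsub>M'\<^esub>} = ?d M ?P"
    using dim_image_plus_kernel[OF f fd(1) P] by simp
  have 6: "?d M ?P \<le> ?d M A'"
    using inj by (intro subspace_dim_mono[OF L(5) fd(1) P A(2)]) auto
  show ?thesis using 1 2 3 4 5 6 BB by simp
qed

section \<open>Chains of subrepresentations with prescribed slopes\<close>

lemma chain_less:
  fixes f :: "nat \<Rightarrow> 'a::order"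
  assumes "\<forall>i<l. f i < f (Suc i)"
  shows "i < j \<Longrightarrow> j \<le> l \<Longrightarrow> f i < f j"
proof (induction j)
  case (Suc j)
  then show ?case using assms by (cases "i = j") (auto intro: less_trans)
qed simp

lemma increasing_enumeration_unique:
  fixes f g :: "nat \<Rightarrow> 'a::linorder"
  assumes f: "\<forall>i<l. f i < f (Suc i)" and g: "\<forall>i<m. g i < g (Suc i)"
    and eq: "f ` {..l} = g ` {..m}"
  shows "l = m" and "i \<le> l \<Longrightarrow> f i = g i"
proof -
  have *: "sorted (map h [0..<Suc k])" "distinct (map h [0..<Suc k])"
    if "\<forall>i<k. h i < h (Suc i)" for h :: "nat \<Rightarrow> 'a" and k
  proof -
    have "sorted_wrt (<) (map h [0..<Suc k])"
      unfolding sorted_wrt_iff_nth_less using chain_less[where f = h, OF that] by (auto simp del: upt_Suc)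
    then show "sorted (map h [0..<Suc k])" "distinct (map h [0..<Suc k])"
      using strict_sorted_iff by blast+
  qed
  have s: "set (map h [0..<Suc k]) = h ` {..k}" for h :: "nat \<Rightarrow> 'a" and k
    by (simp del: upt_Suc add: lessThan_Suc_atMost atLeast0LessThan)
  have e: "map f [0..<Suc l] = map g [0..<Suc m]"
    using f g by (intro sorted_distinct_set_unique * ) (auto simp only: s eq)
  then have "length (map f [0..<Suc l]) = length (map g [0..<Suc m])" by (rule arg_cong)
  then show lm: "l = m" by simp
  show "f i = g i" if "i \<le> l"
    using arg_cong[OF e, of "\<lambda>xs. xs ! i"] that lm by (simp del: upt_Suc)
qed


locale findim_representation =
  fixes K :: "('k, 'm) ring_scheme" and Q :: "('v, 'e) pre_digraph"
    and V :: "('v, 'e, 'k, 'b) quiver_rep"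
  assumes findim: "findim_rep K Q V"
    and finite_verts: "finite (verts Q)"
    and tail_in_verts: "\<And>e. e \<in> arcs Q \<Longrightarrow> tail Q e \<in> verts Q"
    and head_in_verts: "\<And>e. e \<in> arcs Q \<Longrightarrow> head Q e \<in> verts Q"
begin

abbreviation sdim :: "('v \<Rightarrow> 'b set) \<Rightarrow> 'v \<Rightarrow> nat" where
  "sdim U x \<equiv> vectorspace.dim K ((vspace V x)\<lparr>carrier := U x\<rparr>)"

definition total_dim :: "('v \<Rightarrow> 'b set) \<Rightarrow> real" where
  "total_dim U = (\<Sum>x\<in>verts Q. real (sdim U x))"

definition weight :: "('v \<Rightarrow> real) \<Rightarrow> ('v \<Rightarrow> 'b set) \<Rightarrow> real" where
  "weight \<alpha> U = (\<Sum>x\<in>verts Q. \<alpha> x * real (sdim U x))"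

abbreviation cap :: "('v \<Rightarrow> 'b set) \<Rightarrow> ('v \<Rightarrow> 'b set) \<Rightarrow> 'v \<Rightarrow> 'b set" where
  "cap U W \<equiv> \<lambda>x. U x \<inter> W x"

text \<open>
  The numerical content of a Harder-Narasimhan filtration. The number \<open>\<mu> k\<close> belongs to the step from \<open>F k\<close> to
  \<open>F (Suc k)\<close>, so slopes are counted from \<open>0\<close>. The piece of \<open>U\<close> in that step has the dimensions of
  \<open>U \<inter> F (Suc k)\<close> minus those of \<open>U \<inter> F k\<close>; the last two clauses say that it has slope at most \<open>\<mu> k\<close>,
  and that the step itself has slope exactly \<open>\<mu> k\<close>. Multiplying out the denominators spares a case
  distinction for pieces that are zero.
\<close>

definition slope_filtration ::
  "('v \<Rightarrow> real) \<Rightarrow> nat \<Rightarrow> (nat \<Rightarrow> real) \<Rightarrow> (nat \<Rightarrow> 'v \<Rightarrow> 'b set) \<Rightarrow> bool" where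
  "slope_filtration \<alpha> l \<mu> F \<longleftrightarrow>
     (\<forall>k\<le>l. subrep K Q (F k) V) \<and>
     (\<forall>x\<in>verts Q. F 0 x = {\<zero>\<^bsub>vspace V x\<^esub>} \<and> F l x = carrier (vspace V x)) \<and>
     (\<forall>k<l. (\<forall>x\<in>verts Q. F k x \<subseteq> F (Suc k) x) \<and> (\<exists>x\<in>verts Q. F k x \<noteq> F (Suc k) x)) \<and>
     (\<forall>k. Suc k < l \<longrightarrow> \<mu> (Suc k) < \<mu> k) \<and>
     (\<forall>k<l. \<forall>U. subrep K Q U V \<longrightarrow>
        weight \<alpha> (cap U (F (Suc k))) - weight \<alpha> (cap U (F k)) \<le>
        \<mu> k * (total_dim (cap U (F (Suc k))) - total_dim (cap U (F k)))) \<and>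
     (\<forall>k<l. weight \<alpha> (F (Suc k)) - weight \<alpha> (F k) =
        \<mu> k * (total_dim (F (Suc k)) - total_dim (F k)))"

lemma vertex_space: "x \<in> verts Q \<Longrightarrow> vectorspace K (vspace V x)"
  "x \<in> verts Q \<Longrightarrow> vectorspace.fin_dim K (vspace V x)"
  using findim by (auto simp: findim_rep_def is_rep_def)

lemma subrep_subspace: "subrep K Q U V \<Longrightarrow> x \<in> verts Q \<Longrightarrow> VectorSpace.subspace K (U x) (vspace V x)"
  by (auto simp: subrep_def)

lemma subrep_cap: "subrep K Q U V \<Longrightarrow> subrep K Q W V \<Longrightarrow> subrep K Q (cap U W) V"
  by (fastforce simp: subrep_def intro: subspace_inter)

lemma total_dim_mono:
  assumes "subrep K Q U V" "subrep K Q W V" "\<And>x. x \<in> verts Q \<Longrightarrow> U x \<subseteq> W x"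
  shows "total_dim U \<le> total_dim W"
    and "total_dim U = total_dim W \<Longrightarrow> x \<in> verts Q \<Longrightarrow> U x = W x"
proof -
  have le: "real (sdim U x) \<le> real (sdim W x)" if "x \<in> verts Q" for x
    using subspace_dim_mono(1)[OF vertex_space[OF that] assms(1,2)[THEN subrep_subspace, OF that] assms(3)[OF that]]
    by simp
  then show "total_dim U \<le> total_dim W" unfolding total_dim_def by (rule sum_mono)
  assume eq: "total_dim U = total_dim W" and x: "x \<in> verts Q"
  have "real (sdim U x) = real (sdim W x)"
    using sum_mono_inv[OF eq[unfolded total_dim_def] le x finite_verts] .
  then show "U x = W x"
    using subspace_dim_mono(2)[OF vertex_space[OF x] assms(1,2)[THEN subrep_subspace, OF x] assms(3)[OF x]]
    by simp
qed

lemma total_dim_cong: "(\<And>x. x \<in> verts Q \<Longrightarrow> U x = W x) \<Longrightarrow> total_dim U = total_dim W"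
  unfolding total_dim_def by (rule sum.cong) auto

lemma weight_cong: "(\<And>x. x \<in> verts Q \<Longrightarrow> U x = W x) \<Longrightarrow> weight \<alpha> U = weight \<alpha> W"
  unfolding weight_def by (rule sum.cong) auto

lemma zero_dims:
  assumes "\<And>x. x \<in> verts Q \<Longrightarrow> U x = {\<zero>\<^bsub>vspace V x\<^esub>}"
  shows "total_dim U = 0" "weight \<alpha> U = 0"
  using assms dim_zero_space[OF vertex_space(1)] by (simp_all add: total_dim_def weight_def)

text \<open>At each vertex, the piece of \<open>U\<close> in \<open>B / A\<close> embeds into \<open>B / A\<close>.\<close>

lemma total_dim_cap_increment:
  assumes "subrep K Q U V" "subrep K Q A V" "subrep K Q B V" "\<And>x. x \<in> verts Q \<Longrightarrow> A x \<subseteq> B x"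
  shows "total_dim (cap U B) - total_dim (cap U A) \<le> total_dim B - total_dim A"
proof -
  have "sdim (cap U B) x + sdim A x \<le> sdim (cap U A) x + sdim B x" if x: "x \<in> verts Q" for x
  proof (rule codim_le_of_injective_mod[where f = "\<lambda>a. a"])
    interpret M: vectorspace K "vspace V x" by (rule vertex_space[OF x])
    show "linear_map K (vspace V x) (vspace V x) (\<lambda>a. a)"
      by (rule linear_map_onto_image) (auto intro: vertex_space[OF x])
  qed (use assms x in \<open>auto intro!: vertex_space subrep_cap subrep_subspace\<close>)
  then have "real (sdim (cap U B) x) + real (sdim A x) \<le> real (sdim (cap U A) x) + real (sdim B x)"
    if "x \<in> verts Q" for x
    using that by (metis of_nat_add of_nat_mono)
  then have "total_dim (cap U B) + total_dim A \<le> total_dim (cap U A) + total_dim B"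
    unfolding total_dim_def sum.distrib[symmetric] by (rule sum_mono)
  then show ?thesis by simp
qed

text \<open>
  Along the filtration, \<open>A U - t * D U\<close> is the sum of its increments \<open>p i\<close>. The \<open>i\<close>-th one is at most
  \<open>(\<mu> i - t)\<close> times the dimension of the piece of \<open>U\<close>. For \<open>i < k\<close> this factor is positive and the piece is at
  most the whole step; for later \<open>i\<close> it is negative and the piece is at least zero. The resulting bounds \<open>q i\<close>
  add up to the value at \<open>F k\<close>. If the totals agree, then every estimate is sharp, so \<open>U\<close> contains each step
  before \<open>k\<close> and meets no later one.
\<close>

lemma slope_filtration_maximises:
  assumes F: "slope_filtration \<alpha> l \<mu> F" and k: "k \<le> l"
    and large: "\<And>i. i < k \<Longrightarrow> t < \<mu> i" and small: "\<And>i. k \<le> i \<Longrightarrow> i < l \<Longrightarrow> \<mu> i < t"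
    and U: "subrep K Q U V"
  shows "weight \<alpha> U - t * total_dim U \<le> weight \<alpha> (F k) - t * total_dim (F k)"
    and "weight \<alpha> U - t * total_dim U = weight \<alpha> (F k) - t * total_dim (F k) \<Longrightarrow>
      x \<in> verts Q \<Longrightarrow> U x = F k x"
proof -
  have sub: "subrep K Q (F i) V" if "i \<le> l" for i using F that by (auto simp: slope_filtration_def)
  have F0: "F 0 x = {\<zero>\<^bsub>vspace V x\<^esub>}" and Fl: "F l x = carrier (vspace V x)" if "x \<in> verts Q" for x
    using F that by (auto simp: slope_filtration_def)
  have step: "F i x \<subseteq> F (Suc i) x" if "i < l" "x \<in> verts Q" for i x
    using F that by (auto simp: slope_filtration_def)
  have bound: "weight \<alpha> (cap U (F (Suc i))) - weight \<alpha> (cap U (F i)) \<le>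
        \<mu> i * (total_dim (cap U (F (Suc i))) - total_dim (cap U (F i)))" if "i < l" for i
    using F that U by (auto simp: slope_filtration_def)
  have exact: "weight \<alpha> (F (Suc i)) - weight \<alpha> (F i) =
        \<mu> i * (total_dim (F (Suc i)) - total_dim (F i))" if "i < l" for i
    using F that by (auto simp: slope_filtration_def)
  have UV: "U x \<subseteq> carrier (vspace V x)" and U0: "\<zero>\<^bsub>vspace V x\<^esub> \<in> U x" if "x \<in> verts Q" for x
    using subrep_subspace[OF U that] by (auto simp: subspace_iff[OF vertex_space(1)[OF that]])
  define a d b c where "a i = weight \<alpha> (cap U (F i))" and "d i = total_dim (cap U (F i))"
    and "b i = weight \<alpha> (F i)" and "c i = total_dim (F i)" for i
  have ends: "a 0 = 0" "d 0 = 0" "b 0 = 0" "c 0 = 0" "a l = weight \<alpha> U" "d l = total_dim U"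
    unfolding a_def b_def c_def d_def
    by (intro zero_dims weight_cong total_dim_cong; use F0 Fl UV U0 in blast)+
  have d_le: "d (Suc i) - d i \<le> c (Suc i) - c i" if "i < l" for i
    unfolding c_def d_def using that by (intro total_dim_cap_increment U sub step) auto
  have d_nonneg: "0 \<le> d (Suc i) - d i" if "i < l" for i
  proof -
    have "d i \<le> d (Suc i)"
      unfolding d_def using that step by (intro total_dim_mono subrep_cap U sub) auto
    then show ?thesis by simp
  qed
  define p q where "p i = (a (Suc i) - a i) - t * (d (Suc i) - d i)"
    and "q i = (if i < k then (\<mu> i - t) * (c (Suc i) - c i) else 0)" for i
  have p_le: "p i \<le> (\<mu> i - t) * (d (Suc i) - d i)" if "i < l" for i
    using bound[OF that] unfolding p_def a_def d_def by (simp add: algebra_simps)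
  have le_q: "(\<mu> i - t) * (d (Suc i) - d i) \<le> q i" if "i < l" for i
  proof (cases "i < k")
    case True
    then show ?thesis using d_le[OF that] large[OF True] unfolding q_def
      by (simp add: mult_left_mono)
  next
    case False
    then show ?thesis using d_nonneg[OF that] small[of i] that unfolding q_def
      by (simp add: mult_nonpos_nonneg)
  qed
  have telescope: "(\<Sum>i<n. (f (Suc i) - f i) - t * (g (Suc i) - g i)) = (f n - f 0) - t * (g n - g 0)"
    for n and f g :: "nat \<Rightarrow> real"
    by (induction n) (auto simp: algebra_simps)
  have sum_p: "sum p {..<l} = weight \<alpha> U - t * total_dim U"
    unfolding p_def telescope ends by simp
  have "sum q {..<l} = (\<Sum>i<k. (b (Suc i) - b i) - t * (c (Suc i) - c i))"
  proof (rule sum.mono_neutral_cong_right)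
    show "\<forall>i\<in>{..<l} - {..<k}. q i = 0" by (auto simp: q_def)
    show "q i = (b (Suc i) - b i) - t * (c (Suc i) - c i)" if "i \<in> {..<k}" for i
      using that exact[of i] k by (simp add: q_def b_def c_def algebra_simps)
  qed (use k in auto)
  also have "\<dots> = weight \<alpha> (F k) - t * total_dim (F k)"
    unfolding telescope ends by (simp add: b_def c_def)
  finally have sum_q: "sum q {..<l} = weight \<alpha> (F k) - t * total_dim (F k)" .
  have pq: "p i \<le> q i" if "i \<in> {..<l}" for i using p_le[of i] le_q[of i] that by auto
  show "weight \<alpha> U - t * total_dim U \<le> weight \<alpha> (F k) - t * total_dim (F k)"
    unfolding sum_p[symmetric] sum_q[symmetric] by (rule sum_mono) (rule pq)
  assume "weight \<alpha> U - t * total_dim U = weight \<alpha> (F k) - t * total_dim (F k)" and x: "x \<in> verts Q"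
  then have "sum p {..<l} = sum q {..<l}" by (simp add: sum_p sum_q)
  then have eq: "(\<mu> i - t) * (d (Suc i) - d i) = q i" if "i < l" for i
    using sum_mono_inv[of p "{..<l}" q i] pq p_le[OF that] le_q[OF that] that by fastforce
  have below: "d (Suc i) - d i = c (Suc i) - c i" if "i < k" for i
    using eq[of i] that k large[OF that] by (simp add: q_def)
  have "d k - d 0 = c k - c 0"
    unfolding sum_lessThan_telescope[symmetric] by (rule sum.cong) (auto simp: below)
  then have "d k = c k" by (simp add: ends)
  then have "total_dim (cap U (F k)) = total_dim (F k)" by (simp add: c_def d_def)
  then have 1: "U x \<inter> F k x = F k x"
    by (rule total_dim_mono(2)[OF subrep_cap[OF U sub[OF k]] sub[OF k] _ _ x, rotated]) auto
  have above: "d (Suc i) = d i" if "k \<le> i" "i < l" for i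
    using eq[of i] that small[OF that] by (simp add: q_def)
  have "d j = d k" if "k \<le> j" "j \<le> l" for j
    using that by (induction j rule: dec_induct) (auto simp: above)
  then have "d l = d k" using k by blast
  then have "total_dim (cap U (F k)) = total_dim U" by (simp add: ends d_def[symmetric])
  then have "U x \<inter> F k x = U x"
    by (rule total_dim_mono(2)[OF subrep_cap[OF U sub[OF k]] U _ _ x, rotated]) auto
  with 1 show "U x = F k x" by simp
qed

lemma slope_filtration_decreasing:
  assumes "slope_filtration \<alpha> l \<mu> F" "i < j" "j < l"
  shows "\<mu> j < \<mu> i"
proof -
  have "- \<mu> i < - \<mu> j"
    by (rule chain_less[where f = "\<lambda>i. - \<mu> i" and l = "l - 1"])
      (use assms in \<open>auto simp: slope_filtration_def\<close>)
  then show ?thesis by simp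
qed

text \<open>
  Choose \<open>t\<close> between the slopes of \<open>F\<close> on the two sides of \<open>F k\<close>, and different from all the slopes of
  \<open>G\<close>. Then both \<open>F k\<close> and a suitable term of \<open>G\<close> are the unique maximiser for \<open>t\<close>.
\<close>

lemma slope_filtration_term_occurs:
  assumes F: "slope_filtration \<alpha> l \<mu> F" and G: "slope_filtration \<alpha> m \<nu> G" and k: "k \<le> l"
  shows "\<exists>k'\<le>m. \<forall>x\<in>verts Q. F k x = G k' x"
proof -
  \<comment> \<open>At the ends of the filtration one of the two neighbouring slopes is missing; then any bound will do.\<close>
  define lo where "lo = (if k < l then \<mu> k else if k > 0 then \<mu> (k - 1) - 1 else 0)"
  define hi where "hi = (if k > 0 then \<mu> (k - 1) else lo + 1)"
  have "lo < hi"
    using slope_filtration_decreasing[OF F, of "k - 1" k] by (auto simp: lo_def hi_def)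
  then have "infinite ({lo<..<hi} - \<nu> ` {..<m})" by (simp add: infinite_Ioo)
  then obtain t where t: "lo < t" "t < hi" "t \<notin> \<nu> ` {..<m}"
    by (metis Diff_iff all_not_in_conv finite.emptyI greaterThanLessThan_iff)
  have large: "t < \<mu> i" if "i < k" for i
  proof -
    have "i < k - 1 \<or> i = k - 1" "k - 1 < l" using that k by auto
    then show ?thesis
      using slope_filtration_decreasing[OF F, of i "k - 1"] that t by (auto simp: hi_def)
  qed
  have small: "\<mu> i < t" if "k \<le> i" "i < l" for i
    using slope_filtration_decreasing[OF F, of k i] that t by (cases "i = k") (auto simp: lo_def)
  \<comment> \<open>The term of \<open>G\<close> is the one after the last step whose slope exceeds \<open>t\<close>.\<close>
  define S where "S = {i. i \<le> m \<and> (\<forall>j<i. t < \<nu> j)}"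
  have S: "finite S" "0 \<in> S" by (auto simp: S_def)
  define k' where "k' = Max S"
  have k': "k' \<in> S" using S Max_in unfolding k'_def by blast
  have small': "\<nu> i < t" if "k' \<le> i" "i < m" for i
  proof (rule ccontr)
    assume "\<not> \<nu> i < t"
    with t(3) that have "t < \<nu> i" by (metis imageI lessThan_iff not_less_iff_gr_or_eq)
    then have "t < \<nu> j" if "j < Suc i" for j
      using slope_filtration_decreasing[OF G, of j i] that \<open>i < m\<close> by (cases "j = i") auto
    then have "Suc i \<in> S" using that by (auto simp: S_def)
    then have "Suc i \<le> k'" using S unfolding k'_def by simp
    with that show False by simp
  qed
  have subF: "subrep K Q (F k) V" and subG: "subrep K Q (G k') V"
    using F G k k' by (auto simp: slope_filtration_def S_def)
  have k'm: "k' \<le> m" and large': "\<And>i. i < k' \<Longrightarrow> t < \<nu> i" using k' by (auto simp: S_def)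
  note maxF = slope_filtration_maximises[OF F k large small subG]
  note maxG = slope_filtration_maximises[OF G k'm large' small' subF]
  have "F k x = G k' x" if "x \<in> verts Q" for x
    using maxF(1) maxG(1) by (intro maxG(2) that) auto
  then show ?thesis using k'm by blast
qed

text \<open>
  Each filtration has the terms of the other, and total dimension increases strictly along both. So
  the dimensions, and with them the terms, are enumerated in the same order.
\<close>

theorem slope_filtration_unique:
  assumes F: "slope_filtration \<alpha> l \<mu> F" and G: "slope_filtration \<alpha> m \<nu> G"
  shows "l = m" and "k \<le> l \<Longrightarrow> x \<in> verts Q \<Longrightarrow> F k x = G k x"
proof -
  have mono: "\<forall>i<n. total_dim (H i) < total_dim (H (Suc i))"
    if "slope_filtration \<alpha> n \<kappa> H" for H n \<kappa>
  proof (intro allI impI)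
    fix i assume "i < n"
    have s: "subrep K Q (H i) V" "subrep K Q (H (Suc i)) V"
      "\<And>x. x \<in> verts Q \<Longrightarrow> H i x \<subseteq> H (Suc i) x" and ne: "\<exists>x\<in>verts Q. H i x \<noteq> H (Suc i) x"
      using that \<open>i < n\<close> by (auto simp: slope_filtration_def)
    show "total_dim (H i) < total_dim (H (Suc i))"
      using total_dim_mono[OF s] ne by (metis order_le_less)
  qed
  have "(\<lambda>k. total_dim (F k)) ` {..l} \<subseteq> (\<lambda>k. total_dim (G k)) ` {..m}"
    if F: "slope_filtration \<alpha> l \<mu> F" and G: "slope_filtration \<alpha> m \<nu> G" for F G l m \<mu> \<nu>
  proof (rule image_subsetI)
    fix k assume "k \<in> {..l}"
    then obtain k' where "k' \<le> m" "\<forall>x\<in>verts Q. F k x = G k' x"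
      using slope_filtration_term_occurs[OF F G, of k] by auto
    then show "total_dim (F k) \<in> (\<lambda>k. total_dim (G k)) ` {..m}"
      using total_dim_cong[of "F k" "G k'"] by auto
  qed
  from this[OF F G] this[OF G F]
  have eq: "(\<lambda>k. total_dim (F k)) ` {..l} = (\<lambda>k. total_dim (G k)) ` {..m}" by blast
  note enum = increasing_enumeration_unique[OF mono[OF F] mono[OF G] eq]
  show "l = m" by (rule enum(1))
  assume k: "k \<le> l" and x: "x \<in> verts Q"
  obtain k' where k': "k' \<le> m" "\<forall>x\<in>verts Q. F k x = G k' x"
    using slope_filtration_term_occurs[OF F G k] by blast
  have "total_dim (G k') = total_dim (G k)"
    using total_dim_cong[of "F k" "G k'"] k'(2) enum(2)[OF k] by auto
  then have "k' = k"
    using chain_less[where f = "\<lambda>k. total_dim (G k)", OF mono[OF G]] k k' enum(1)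
    by (metis less_irrefl linorder_neqE_nat)
  with k' x show "F k x = G k x" by blast
qed

end

section \<open>Subquotients of a representation\<close>

lemma vspace_restrict_rep [simp]: "vspace (restrict_rep V W) x = (vspace V x)\<lparr>carrier := W x\<rparr>"
  and emap_restrict_rep [simp]: "emap (restrict_rep V W) = emap V"
  by (simp_all add: restrict_rep_def)

lemma vspace_quot_rep [simp]: "vspace (quot_rep Q V U) x = quot_module (vspace V x) (U x)"
  by (simp add: quot_rep_def)

lemma a_r_coset_restrict [simp]: "N +>\<^bsub>M\<lparr>carrier := A\<rparr>\<^esub> a = N +>\<^bsub>M\<^esub> a"
  by (simp add: a_r_coset_def')

text \<open>
  The edge maps of a quotient are defined as unions over cosets. They are the induced maps because the
  edge map sends the subspace at the tail into the one at the head.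
\<close>

lemma emap_quot_rep:
  assumes V: "is_rep K Q V" and U: "subrep K Q U V" and e: "e \<in> arcs Q"
    and wf: "tail Q e \<in> verts Q" "head Q e \<in> verts Q"
    and a: "a \<in> carrier (vspace V (tail Q e))"
  shows "emap (quot_rep Q V U) e (U (tail Q e) +>\<^bsub>vspace V (tail Q e)\<^esub> a) =
    U (head Q e) +>\<^bsub>vspace V (head Q e)\<^esub> emap V e a"
proof -
  let ?t = "tail Q e" and ?h = "head Q e"
  have f: "linear_map K (vspace V ?t) (vspace V ?h) (emap V e)"
    using V e by (auto simp: is_rep_def)
  note L = linear_map_simps[OF f]
  have Ut: "VectorSpace.subspace K (U ?t) (vspace V ?t)" and Uh: "VectorSpace.subspace K (U ?h) (vspace V ?h)"
    and fU: "emap V e ` U ?t \<subseteq> U ?h"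
    using U wf e by (auto simp: subrep_def)
  have UtV: "U ?t \<subseteq> carrier (vspace V ?t)" using Ut by (simp add: subspace_iff[OF L(5)])
  note ct = linear_coset_map[OF Ut] and ch = linear_coset_map[OF Uh]
  have *: "U ?h +>\<^bsub>vspace V ?h\<^esub> emap V e b = U ?h +>\<^bsub>vspace V ?h\<^esub> emap V e a"
    if b: "b \<in> U ?t +>\<^bsub>vspace V ?t\<^esub> a" for b
  proof -
    obtain h where h: "h \<in> U ?t" "b = h \<oplus>\<^bsub>vspace V ?t\<^esub> a"
      using b unfolding a_r_coset_def' by blast
    have "emap V e b = emap V e h \<oplus>\<^bsub>vspace V ?h\<^esub> emap V e a"
      using L(2)[of h a] h UtV a by blast
    moreover have "emap V e h \<in> U ?h" using fU h by blast
    ultimately have "emap V e b \<in> U ?h +>\<^bsub>vspace V ?h\<^esub> emap V e a"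
      unfolding a_r_coset_def' by blast
    then show ?thesis by (rule ch(4)[OF L(1)[OF a]])
  qed
  have "U ?t +>\<^bsub>vspace V ?t\<^esub> a \<noteq> {}" using ct(5)[OF a] by blast
  then have "(\<Union>b\<in>U ?t +>\<^bsub>vspace V ?t\<^esub> a. U ?h +>\<^bsub>vspace V ?h\<^esub> emap V e b) =
      U ?h +>\<^bsub>vspace V ?h\<^esub> emap V e a"
    by (rule SUP_eq_const) (rule *)
  then show ?thesis by (simp add: quot_rep_def)
qed


context findim_representation
begin

lemma edge_linear: "e \<in> arcs Q \<Longrightarrow> linear_map K (vspace V (tail Q e)) (vspace V (head Q e)) (emap V e)"
  using findim by (auto simp: findim_rep_def is_rep_def)

lemma subrep_edge: "subrep K Q U V \<Longrightarrow> e \<in> arcs Q \<Longrightarrow> a \<in> U (tail Q e) \<Longrightarrow> emap V e a \<in> U (head Q e)"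
  unfolding subrep_def by blast

lemma is_rep_restrict:
  assumes "subrep K Q A V"
  shows "is_rep K Q (restrict_rep V A)"
  unfolding is_rep_def
proof (intro conjI ballI)
  show "vectorspace K (vspace (restrict_rep V A) x)" if "x \<in> verts Q" for x
    using vectorspace.subspace_is_vs[OF vertex_space(1)[OF that] subrep_subspace[OF assms that]] by simp
  fix e assume e: "e \<in> arcs Q"
  show "linear_map K (vspace (restrict_rep V A) (tail Q e)) (vspace (restrict_rep V A) (head Q e))
      (emap (restrict_rep V A) e)"
    using subrep_edge[OF assms e] e
    by (auto intro!: linear_map_between_subspaces edge_linear subrep_subspace assms tail_in_verts
        head_in_verts)
qed

lemma subrep_restrict:
  assumes "subrep K Q A V" "subrep K Q N V" "\<And>x. x \<in> verts Q \<Longrightarrow> N x \<subseteq> A x"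
  shows "subrep K Q N (restrict_rep V A)"
  using assms by (auto simp: subrep_def intro!: subspace_of_subspace)

lemma emap_subquotient:
  assumes A: "subrep K Q A V" and N: "subrep K Q N V" and NA: "\<And>x. x \<in> verts Q \<Longrightarrow> N x \<subseteq> A x"
    and e: "e \<in> arcs Q" and a: "a \<in> A (tail Q e)"
  shows "emap (quot_rep Q (restrict_rep V A) N) e (N (tail Q e) +>\<^bsub>vspace V (tail Q e)\<^esub> a) =
    N (head Q e) +>\<^bsub>vspace V (head Q e)\<^esub> emap V e a"
  using emap_quot_rep[OF is_rep_restrict[OF A] subrep_restrict[OF A N NA] e tail_in_verts[OF e]
      head_in_verts[OF e], of a] a by simp

definition image_in_subquotient :: "('v \<Rightarrow> 'b set) \<Rightarrow> ('v \<Rightarrow> 'b set) \<Rightarrow> ('v \<Rightarrow> 'b set) \<Rightarrow> 'v \<Rightarrow> 'b set set"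
  where "image_in_subquotient A N U x = (\<lambda>a. N x +>\<^bsub>vspace V x\<^esub> a) ` (U x \<inter> A x)"

context
  fixes A N :: "'v \<Rightarrow> 'b set"
  assumes A: "subrep K Q A V" and N: "subrep K Q N V" and NA: "\<And>x. x \<in> verts Q \<Longrightarrow> N x \<subseteq> A x"
begin

abbreviation (input) "SQ \<equiv> quot_rep Q (restrict_rep V A) N"

lemma coset_map_subquotient:
  assumes "x \<in> verts Q"
  shows "linear_map K ((vspace V x)\<lparr>carrier := A x\<rparr>) (vspace SQ x) (\<lambda>a. N x +>\<^bsub>vspace V x\<^esub> a)"
    and "(\<lambda>a. N x +>\<^bsub>vspace V x\<^esub> a) ` A x = carrier (vspace SQ x)"
  using linear_coset_map(1,2)[OF subspace_of_subspace[OF subrep_subspace[OF A assms]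
      subrep_subspace[OF N assms] NA[OF assms]]] by simp_all

lemma subrep_image_in_subquotient:
  assumes U: "subrep K Q U V"
  shows "subrep K Q (image_in_subquotient A N U) SQ"
  unfolding subrep_def
proof (intro conjI ballI)
  fix x assume x: "x \<in> verts Q"
  show "VectorSpace.subspace K (image_in_subquotient A N U x) (vspace SQ x)"
    unfolding image_in_subquotient_def
    by (intro subspace_image[OF coset_map_subquotient(1)[OF x]] subspace_of_subspace
        subspace_inter subrep_subspace A U x) auto
next
  fix e assume e: "e \<in> arcs Q"
  have "emap V e a \<in> U (head Q e) \<inter> A (head Q e)" if "a \<in> U (tail Q e) \<inter> A (tail Q e)" for a
    using that subrep_edge[OF U e] subrep_edge[OF A e] by blast
  then show "emap SQ e ` image_in_subquotient A N U (tail Q e) \<subseteq> image_in_subquotient A N U (head Q e)"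
    unfolding image_in_subquotient_def using emap_subquotient[OF A N NA e] by auto
qed

lemma dim_image_in_subquotient:
  assumes U: "subrep K Q U V" and x: "x \<in> verts Q"
  shows "real (vectorspace.dim K (vspace (restrict_rep SQ (image_in_subquotient A N U)) x)) =
    real (sdim (cap U A) x) - real (sdim (cap U N) x)"
proof -
  have "(U x \<inter> A x) \<inter> N x = U x \<inter> N x" using NA[OF x] by auto
  then have "vectorspace.dim K (vspace (restrict_rep SQ (image_in_subquotient A N U)) x) +
      sdim (cap U N) x = sdim (cap U A) x"
    using dim_image_in_quotient[OF vertex_space[OF x] subrep_subspace[OF A x] subrep_subspace[OF N x]
        subspace_inter[OF subrep_subspace[OF U x] subrep_subspace[OF A x]] NA[OF x] Int_lower2]
    by (simp add: image_in_subquotient_def)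
  then show ?thesis by linarith
qed

lemma dim_subquotient:
  assumes x: "x \<in> verts Q"
  shows "real (vectorspace.dim K (vspace SQ x)) = real (sdim A x) - real (sdim N x)"
proof -
  have "image_in_subquotient A N A x = carrier (vspace SQ x)"
    using coset_map_subquotient(2)[OF x] by (simp add: image_in_subquotient_def)
  then have "vspace (restrict_rep SQ (image_in_subquotient A N A)) x = vspace SQ x" by simp
  moreover have "cap A N x = N x" using NA[OF x] by auto
  ultimately show ?thesis using dim_image_in_subquotient[OF A x] by simp
qed

text \<open>
  Semistability of \<open>A / N\<close> is applied to the image of \<open>U \<inter> A\<close>, whose dimensions are those of \<open>U \<inter> A\<close> minus
  those of \<open>U \<inter> N\<close>. Semistability says nothing about a zero image, but then both sides vanish.
\<close>

lemma semistable_subquotient_bound: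
  assumes st: "semistable K Q \<alpha> SQ" and U: "subrep K Q U V"
  shows "weight \<alpha> (cap U A) - weight \<alpha> (cap U N) \<le>
    slope K Q \<alpha> SQ * (total_dim (cap U A) - total_dim (cap U N))"
proof -
  let ?U = "image_in_subquotient A N U"
  let ?R = "restrict_rep SQ ?U"
  let ?d = "\<lambda>x. real (vectorspace.dim K (vspace ?R x))"
  have w: "weight \<alpha> (cap U A) - weight \<alpha> (cap U N) = (\<Sum>x\<in>verts Q. \<alpha> x * ?d x)"
    unfolding weight_def sum_subtractf[symmetric]
    by (intro sum.cong refl) (simp only: dim_image_in_subquotient[OF U] right_diff_distrib)
  have t: "total_dim (cap U A) - total_dim (cap U N) = (\<Sum>x\<in>verts Q. ?d x)"
    unfolding total_dim_def sum_subtractf[symmetric]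
    by (intro sum.cong refl) (simp only: dim_image_in_subquotient[OF U])
  show ?thesis
  proof (cases "(\<Sum>x\<in>verts Q. ?d x) = 0")
    case True
    then have "\<forall>x\<in>verts Q. ?d x = 0"
      using finite_verts by (subst (asm) sum_nonneg_eq_0_iff) auto
    then show ?thesis unfolding w t by simp
  next
    case False
    have "nonzero_rep Q ?R"
    proof (rule ccontr)
      assume zero: "\<not> nonzero_rep Q ?R"
      have "?d x = 0" if x: "x \<in> verts Q" for x
      proof -
        have "?U x = {\<zero>\<^bsub>vspace SQ x\<^esub>}" using zero x by (simp add: nonzero_rep_def)
        then show ?thesis
          using dim_zero_space[OF linear_map_simps(6)[OF coset_map_subquotient(1)[OF x]]] by simp
      qed
      with False show False by simp
    qed
    then have "slope K Q \<alpha> ?R \<le> slope K Q \<alpha> SQ"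
      using st subrep_image_in_subquotient[OF U] by (auto simp: semistable_def)
    moreover have "0 < (\<Sum>x\<in>verts Q. ?d x)"
      using False sum_nonneg[of "verts Q" ?d] by linarith
    ultimately show ?thesis
      unfolding w t by (simp add: slope_def[of K Q \<alpha> ?R] pos_divide_le_eq)
  qed
qed

lemma weight_subquotient:
  "weight \<alpha> A - weight \<alpha> N = slope K Q \<alpha> SQ * (total_dim A - total_dim N)"
proof -
  let ?d = "\<lambda>x. real (vectorspace.dim K (vspace SQ x))"
  have w: "weight \<alpha> A - weight \<alpha> N = (\<Sum>x\<in>verts Q. \<alpha> x * ?d x)"
    unfolding weight_def sum_subtractf[symmetric]
    by (intro sum.cong refl) (simp only: dim_subquotient right_diff_distrib)
  have t: "total_dim A - total_dim N = (\<Sum>x\<in>verts Q. ?d x)"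
    unfolding total_dim_def sum_subtractf[symmetric]
    by (intro sum.cong refl) (simp only: dim_subquotient)
  show ?thesis
  proof (cases "(\<Sum>x\<in>verts Q. ?d x) = 0")
    case True
    then have "\<forall>x\<in>verts Q. ?d x = 0"
      using finite_verts by (subst (asm) sum_nonneg_eq_0_iff) auto
    then show ?thesis unfolding w t by simp
  next
    case False
    then show ?thesis unfolding w t slope_def by simp
  qed
qed

end

theorem hn_filtration_imp_slope_filtration:
  assumes "hn_filtration K Q \<alpha> V l F"
  shows "slope_filtration \<alpha> l (\<lambda>k. slope K Q \<alpha> (filt_quot Q V F (Suc k))) F"
proof -
  have sub: "subrep K Q (F k) V" if "k \<le> l" for k
    using assms that by (auto simp: hn_filtration_def)
  have step: "(\<forall>x\<in>verts Q. F k x \<subseteq> F (Suc k) x) \<and> (\<exists>x\<in>verts Q. F k x \<noteq> F (Suc k) x)" if "k < l" for k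
    using assms that unfolding hn_filtration_def
    by (metis Suc_leI atLeastAtMost_iff diff_Suc_1 le_add1 plus_1_eq_Suc)
  have st: "semistable K Q \<alpha> (quot_rep Q (restrict_rep V (F (Suc k))) (F k))" if "k < l" for k
  proof -
    have "semistable K Q \<alpha> (filt_quot Q V F (Suc k))"
      using assms that by (auto simp: hn_filtration_def)
    then show ?thesis by (simp add: filt_quot_def)
  qed
  have dec: "slope K Q \<alpha> (filt_quot Q V F (Suc (Suc k))) < slope K Q \<alpha> (filt_quot Q V F (Suc k))"
    if "Suc k < l" for k
  proof -
    have "Suc k \<in> {1..<l}" using that by simp
    then show ?thesis using assms unfolding hn_filtration_def by force
  qed
  show ?thesis
    unfolding slope_filtration_def
  proof (intro conjI allI impI)
    show "\<forall>x\<in>verts Q. F 0 x = {\<zero>\<^bsub>vspace V x\<^esub>} \<and> F l x = carrier (vspace V x)"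
      using assms by (simp add: hn_filtration_def)
    fix k assume k: "k < l"
    have incl: "F k x \<subseteq> F (Suc k) x" if "x \<in> verts Q" for x using step[OF k] that by blast
    show "weight \<alpha> (F (Suc k)) - weight \<alpha> (F k) =
        slope K Q \<alpha> (filt_quot Q V F (Suc k)) * (total_dim (F (Suc k)) - total_dim (F k))"
      using weight_subquotient[OF sub sub incl] k by (simp add: filt_quot_def)
    fix U assume "subrep K Q U V"
    then show "weight \<alpha> (cap U (F (Suc k))) - weight \<alpha> (cap U (F k)) \<le>
        slope K Q \<alpha> (filt_quot Q V F (Suc k)) *
        (total_dim (cap U (F (Suc k))) - total_dim (cap U (F k)))"
      using semistable_subquotient_bound[OF sub sub incl st[OF k]] k by (simp add: filt_quot_def)
  qed (use sub step dec in blast)+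
qed

end

text \<open>First isomorphism theorem. The induced map sends a coset to the only element of its image under \<open>g\<close>.\<close>

lemma bij_map_on_quotient:
  fixes M :: "('k, 'b) module"
  assumes g: "linear_map K M W g" and onto: "g ` carrier M = carrier W"
    and N: "VectorSpace.subspace K N M" and ker: "\<And>a. a \<in> carrier M \<Longrightarrow> g a = \<zero>\<^bsub>W\<^esub> \<longleftrightarrow> a \<in> N"
  defines "h \<equiv> \<lambda>A. the_elem (g ` A)"
  shows "a \<in> carrier M \<Longrightarrow> h (N +>\<^bsub>M\<^esub> a) = g a"
    and "linear_map K (quot_module M N) W h"
    and "bij_betw h (carrier (quot_module M N)) (carrier W)"
proof -
  note L = linear_map_simps[OF g]
  note c = linear_coset_map[OF N] and C = linear_map_simps[OF linear_coset_map(1)[OF N]]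
  interpret W: vectorspace K W by (rule L(6))
  have NM: "N \<subseteq> carrier M" using N by (simp add: subspace_iff[OF L(5)])
  show h: "h (N +>\<^bsub>M\<^esub> a) = g a" if a: "a \<in> carrier M" for a
  proof -
    have "g (n \<oplus>\<^bsub>M\<^esub> a) = g a" if "n \<in> N" for n
    proof -
      have "g n = \<zero>\<^bsub>W\<^esub>" using ker NM that by blast
      then show ?thesis using L(2)[of n a] L(1)[OF a] NM that a by auto
    qed
    then have "g ` (N +>\<^bsub>M\<^esub> a) \<subseteq> {g a}" unfolding a_r_coset_def' by auto
    moreover have "g a \<in> g ` (N +>\<^bsub>M\<^esub> a)" using c(5)[OF a] by blast
    ultimately have "g ` (N +>\<^bsub>M\<^esub> a) = {g a}" by blast
    then show ?thesis by (simp add: h_def)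
  qed
  have im: "carrier (quot_module M N) = (\<lambda>a. N +>\<^bsub>M\<^esub> a) ` carrier M" using c(2) by simp
  interpret M: vectorspace K M by (rule L(5))
  have "h \<in> LinearCombinations.module_hom K (quot_module M N) W"
    unfolding LinearCombinations.module_hom_def im
    using L(1,2,3) by (auto simp: h C(2,3)[symmetric])
  then show lin: "linear_map K (quot_module M N) W h"
    using L(6) C(6) by (simp add: linear_map_def mod_hom_def mod_hom_axioms_def vectorspace_def)
  interpret h: linear_map K "quot_module M N" W h by (rule lin)
  have "{A \<in> carrier (quot_module M N). h A = \<zero>\<^bsub>W\<^esub>} = {\<zero>\<^bsub>quot_module M N\<^esub>}"
  proof
    show "{A \<in> carrier (quot_module M N). h A = \<zero>\<^bsub>W\<^esub>} \<subseteq> {\<zero>\<^bsub>quot_module M N\<^esub>}"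
    proof (rule subsetI)
      fix X assume "X \<in> {A \<in> carrier (quot_module M N). h A = \<zero>\<^bsub>W\<^esub>}"
      then have X: "X \<in> carrier (quot_module M N)" "h X = \<zero>\<^bsub>W\<^esub>" by auto
      then obtain a where a: "a \<in> carrier M" "X = N +>\<^bsub>M\<^esub> a" unfolding im by blast
      then have "a \<in> N" using X h ker by simp
      then show "X \<in> {\<zero>\<^bsub>quot_module M N\<^esub>}" using a c(3) by simp
    qed
  qed (use h.f0_is_0 in simp)
  then have "inj_on h (carrier (quot_module M N))"
    by (intro h.Ke0_imp_inj) (simp add: h.ker_def)
  moreover have "h ` carrier (quot_module M N) = carrier W"
    unfolding im image_image onto[symmetric] using h by (intro image_cong) auto
  ultimately show "bij_betw h (carrier (quot_module M N)) (carrier W)" by (simp add: bij_betw_def)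
qed

context findim_representation
begin

lemma subquotient_iso:
  assumes A: "subrep K Q A V" and N: "subrep K Q N V" and NA: "\<And>x. x \<in> verts Q \<Longrightarrow> N x \<subseteq> A x"
    and onto: "\<And>x. x \<in> verts Q \<Longrightarrow> g x ` A x = carrier (vspace W x)"
    and add: "\<And>x a b. x \<in> verts Q \<Longrightarrow> a \<in> A x \<Longrightarrow> b \<in> A x \<Longrightarrow>
      g x (a \<oplus>\<^bsub>vspace V x\<^esub> b) = g x a \<oplus>\<^bsub>vspace W x\<^esub> g x b"
    and smult: "\<And>x c a. x \<in> verts Q \<Longrightarrow> c \<in> carrier K \<Longrightarrow> a \<in> A x \<Longrightarrow>
      g x (c \<odot>\<^bsub>vspace V x\<^esub> a) = c \<odot>\<^bsub>vspace W x\<^esub> g x a"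
    and ker: "\<And>x a. x \<in> verts Q \<Longrightarrow> a \<in> A x \<Longrightarrow> g x a = \<zero>\<^bsub>vspace W x\<^esub> \<longleftrightarrow> a \<in> N x"
    and comm: "\<And>e a. e \<in> arcs Q \<Longrightarrow> a \<in> A (tail Q e) \<Longrightarrow>
      g (head Q e) (emap V e a) = emap W e (g (tail Q e) a)"
  shows "rep_iso K Q (quot_rep Q (restrict_rep V A) N) W"
proof -
  define h where "h x X = the_elem (g x ` X)" for x X
  have lin: "linear_map K ((vspace V x)\<lparr>carrier := A x\<rparr>) (vspace W x) (g x)" if x: "x \<in> verts Q" for x
  proof (rule linear_map_onto_image)
    show "vectorspace K ((vspace V x)\<lparr>carrier := A x\<rparr>)"
      by (rule vectorspace.subspace_is_vs[OF vertex_space(1)[OF x] subrep_subspace[OF A x]])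
    show "g x \<zero>\<^bsub>(vspace V x)\<lparr>carrier := A x\<rparr>\<^esub> = \<zero>\<^bsub>vspace W x\<^esub>"
      using ker[OF x, of "\<zero>\<^bsub>vspace V x\<^esub>"] subrep_subspace[OF A x] subrep_subspace[OF N x]
      by (simp add: subspace_iff[OF vertex_space(1)[OF x]])
  qed (use onto add smult x in auto)
  have NA': "VectorSpace.subspace K (N x) ((vspace V x)\<lparr>carrier := A x\<rparr>)" if x: "x \<in> verts Q" for x
    by (intro subspace_of_subspace subrep_subspace A N NA x)
  have h: "h x (N x +>\<^bsub>vspace V x\<^esub> a) = g x a"
      "linear_map K (quot_module ((vspace V x)\<lparr>carrier := A x\<rparr>) (N x)) (vspace W x) (h x)"
      "bij_betw (h x) (carrier (quot_module ((vspace V x)\<lparr>carrier := A x\<rparr>) (N x))) (carrier (vspace W x))"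
    if x: "x \<in> verts Q" and a: "a \<in> A x" for x a
    using bij_map_on_quotient[OF lin[OF x] _ NA'[OF x]] onto[OF x] ker[OF x] a
    by (simp_all add: h_def[abs_def])
  have ne: "\<exists>a. a \<in> A x" if "x \<in> verts Q" for x
    using subrep_subspace[OF A that] by (auto simp: subspace_iff[OF vertex_space(1)[OF that]])
  show ?thesis
    unfolding rep_iso_def
  proof (intro exI[of _ h] conjI ballI)
    fix x assume x: "x \<in> verts Q"
    obtain a where "a \<in> A x" using ne[OF x] by blast
    from h(2,3)[OF x this]
    show "linear_map K (vspace (quot_rep Q (restrict_rep V A) N) x) (vspace W x) (h x)"
      "bij_betw (h x) (carrier (vspace (quot_rep Q (restrict_rep V A) N) x)) (carrier (vspace W x))"
      by simp_all
  next
    fix e X assume e: "e \<in> arcs Q" and X: "X \<in> carrier (vspace (quot_rep Q (restrict_rep V A) N) (tail Q e))"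
    note t = tail_in_verts[OF e] and hd = head_in_verts[OF e]
    obtain a where a: "a \<in> A (tail Q e)" "X = N (tail Q e) +>\<^bsub>vspace V (tail Q e)\<^esub> a"
      using X coset_map_subquotient(2)[OF A N NA t] by auto
    have "emap V e a \<in> A (head Q e)" by (rule subrep_edge[OF A e a(1)])
    then show "h (head Q e) (emap (quot_rep Q (restrict_rep V A) N) e X) = emap W e (h (tail Q e) X)"
      using a comm[OF e a(1)] by (simp add: emap_subquotient[OF A N NA e] h(1)[OF t] h(1)[OF hd])
  qed
qed

end

lemma rep_iso_dim_eq:
  assumes iso: "rep_iso K Q V W" and x: "x \<in> verts Q" and fd: "vectorspace.fin_dim K (vspace V x)"
  shows "vectorspace.dim K (vspace V x) = vectorspace.dim K (vspace W x)"
proof -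
  obtain \<phi> where f: "linear_map K (vspace V x) (vspace W x) (\<phi> x)"
    and bij: "bij_betw (\<phi> x) (carrier (vspace V x)) (carrier (vspace W x))"
    using iso x by (auto simp: rep_iso_def)
  show ?thesis using linear_map.dim_eq[OF f fd] bij by (auto simp: bij_betw_def)
qed

text \<open>
  Uniqueness of the filtration gives equality of terms only at the vertices of the quiver; that is enough
  because the quotient is built from the values at the ends of edges.
\<close>

lemma filt_quot_cong_iso:
  assumes eq: "\<And>x. x \<in> verts Q \<Longrightarrow> F k x = G k x" "\<And>x. x \<in> verts Q \<Longrightarrow> F (k - 1) x = G (k - 1) x"
    and wf: "\<And>e. e \<in> arcs Q \<Longrightarrow> tail Q e \<in> verts Q" "\<And>e. e \<in> arcs Q \<Longrightarrow> head Q e \<in> verts Q"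
    and iso: "rep_iso K Q (filt_quot Q V G k) W"
  shows "rep_iso K Q (filt_quot Q V F k) W"
proof -
  have "vspace (filt_quot Q V F k) x = vspace (filt_quot Q V G k) x" if "x \<in> verts Q" for x
    using eq that by (simp add: filt_quot_def)
  moreover have "emap (filt_quot Q V F k) e = emap (filt_quot Q V G k) e" if "e \<in> arcs Q" for e
    using eq wf that by (simp add: filt_quot_def quot_rep_def)
  ultimately show ?thesis using iso wf by (simp add: rep_iso_def)
qed

section \<open>Powers of interval modules\<close>

lemma A_quiver_simps [simp]:
  "verts (A_quiver n) = {0..<n}" "arcs (A_quiver n) = {1..<n}"
  "tail (A_quiver n) e = e - 1" "head (A_quiver n) e = e"
  by (simp_all add: A_quiver_def)

lemma euler_stability_A_quiver:
  assumes "x < n"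
  shows "euler_stability (A_quiver n) x = (if x = 0 then 1 else 0)"
proof -
  have "in_arcs (A_quiver n) x = (if x = 0 then {} else {x})"
    using assms by (auto simp: in_arcs_def)
  then show ?thesis by (simp add: euler_stability_def in_degree_def)
qed

text \<open>The summand \<open>I[u, v]\<^sup>d\<close> with \<open>d = d\<^sub>u\<^sub>,\<^sub>v\<close>, indexed by the pair as in \<^const>\<open>interval_sum\<close>.\<close>

definition isotypic :: "('k, 'm) ring_scheme \<Rightarrow> (nat \<Rightarrow> nat \<Rightarrow> nat) \<Rightarrow> nat \<times> nat \<Rightarrow>
    (nat, nat, 'k, nat \<Rightarrow> 'k) quiver_rep" where
  "isotypic K d = (\<lambda>(u, v). pow_rep (interval_rep K u v) (d u v))"

text \<open>The zero vector of a summand does not depend on the vertex. Giving it a name of its own makes this visible.\<close>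

definition isotypic_zero :: "('k, 'm) ring_scheme \<Rightarrow> (nat \<Rightarrow> nat \<Rightarrow> nat) \<Rightarrow> nat \<times> nat \<Rightarrow> nat \<Rightarrow> 'k"
  where "isotypic_zero K d p = (\<lambda>m\<in>{0..<d (fst p) (snd p)}. \<zero>\<^bsub>K\<^esub>)"

lemma interval_sum_simps [simp]:
  "carrier (vspace (interval_sum K S d) x) = (\<Pi>\<^sub>E p\<in>S. carrier (vspace (isotypic K d p) x))"
  "zero (vspace (interval_sum K S d) x) = (\<lambda>p\<in>S. isotypic_zero K d p)"
  "add (vspace (interval_sum K S d) x) f g = (\<lambda>p\<in>S. f p \<oplus>\<^bsub>vspace (isotypic K d p) x\<^esub> g p)"
  "smult (vspace (interval_sum K S d) x) c f = (\<lambda>p\<in>S. c \<odot>\<^bsub>vspace (isotypic K d p) x\<^esub> f p)"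
  "emap (interval_sum K S d) e f = (\<lambda>p\<in>S. emap (isotypic K d p) e (f p))"
  by (auto simp: interval_sum_def dsum_rep_def dsum_module_def isotypic_def isotypic_zero_def
      pow_rep_def interval_rep_def self_module_def intro!: restrict_ext)

lemma zero_isotypic [simp]: "\<zero>\<^bsub>vspace (isotypic K d p) x\<^esub> = isotypic_zero K d p"
  by (auto simp: isotypic_def isotypic_zero_def pow_rep_def dsum_rep_def dsum_module_def
      interval_rep_def self_module_def split: prod.splits)

lemma vspace_isotypic_in_interval:
  "x \<in> {u..v} \<Longrightarrow> y \<in> {u..v} \<Longrightarrow> vspace (isotypic K d (u, v)) x = vspace (isotypic K d (u, v)) y"
  by (simp add: isotypic_def pow_rep_def dsum_rep_def interval_rep_def)

lemma carrier_isotypic: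
  "carrier (vspace (isotypic K d (u, v)) x) =
    {0..<d u v} \<rightarrow>\<^sub>E (if x \<in> {u..v} then carrier K else {\<zero>\<^bsub>K\<^esub>})"
  by (auto simp: isotypic_def pow_rep_def dsum_rep_def dsum_module_def interval_rep_def self_module_def)

lemma carrier_isotypic_outside:
  assumes "x \<notin> {u..v}"
  shows "carrier (vspace (isotypic K d (u, v)) x) = {isotypic_zero K d (u, v)}"
  unfolding carrier_isotypic if_not_P[OF assms] isotypic_zero_def by (simp add: PiE_eq_singleton)

lemma isotypic_zero_ops:
  assumes "ring K"
  shows "isotypic_zero K d p \<in> carrier (vspace (isotypic K d p) x)"
    and "isotypic_zero K d p \<oplus>\<^bsub>vspace (isotypic K d p) x\<^esub> isotypic_zero K d p = isotypic_zero K d p"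
    and "c \<in> carrier K \<Longrightarrow> c \<odot>\<^bsub>vspace (isotypic K d p) x\<^esub> isotypic_zero K d p = isotypic_zero K d p"
    and "emap (isotypic K d p) e (isotypic_zero K d p) = isotypic_zero K d p"
proof -
  interpret ring K by fact
  obtain u v where p: "p = (u, v)" by (cases p)
  show "isotypic_zero K d p \<in> carrier (vspace (isotypic K d p) x)"
    unfolding p carrier_isotypic by (simp add: isotypic_zero_def)
  show "isotypic_zero K d p \<oplus>\<^bsub>vspace (isotypic K d p) x\<^esub> isotypic_zero K d p = isotypic_zero K d p"
    "c \<in> carrier K \<Longrightarrow> c \<odot>\<^bsub>vspace (isotypic K d p) x\<^esub> isotypic_zero K d p = isotypic_zero K d p"
    "emap (isotypic K d p) e (isotypic_zero K d p) = isotypic_zero K d p"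
    unfolding p by (auto simp: isotypic_def isotypic_zero_def pow_rep_def dsum_rep_def dsum_module_def
        interval_rep_def self_module_def intro!: restrict_ext)
qed

lemma emap_isotypic_inside:
  assumes "e - 1 \<in> {u..v}" "e \<in> {u..v}" "f \<in> carrier (vspace (isotypic K d (u, v)) x)"
  shows "emap (isotypic K d (u, v)) e f = f"
proof -
  have "f \<in> extensional {0..<d u v}" using assms(3) by (auto simp: carrier_isotypic PiE_def)
  then have "restrict f {0..<d u v} = f" by (rule extensional_restrict)
  then show ?thesis using assms(1,2) by (simp add: isotypic_def pow_rep_def dsum_rep_def interval_rep_def)
qed

section \<open>The bars from 0 as a filtration\<close>

lemma sorted_list_of_set_nth:
  assumes "finite J"
  shows "set (sorted_list_of_set J) = J" "length (sorted_list_of_set J) = card J"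
    and "i < i' \<Longrightarrow> i' < card J \<Longrightarrow> sorted_list_of_set J ! i < sorted_list_of_set J ! i'"
  using assms strict_sorted_list_of_set[of J] by (auto simp: sorted_wrt_iff_nth_less)

text \<open>The family \<open>\<phi>\<close> is the isomorphism of a barcode decomposition, so \<open>\<phi> x a p\<close> is the \<open>p\<close>-component of \<open>a\<close>.\<close>

locale barcode_representation =
  fixes K :: "('k, 'm) ring_scheme" and n :: nat and V :: "(nat, nat, 'k, 'b) quiver_rep"
    and B :: "(nat \<times> nat) set" and d :: "nat \<Rightarrow> nat \<Rightarrow> nat"
    and \<phi> :: "nat \<Rightarrow> 'b \<Rightarrow> nat \<times> nat \<Rightarrow> nat \<Rightarrow> 'k"
  assumes field: "field K" and n_pos: "n \<ge> 1"
    and findim_A: "findim_rep K (A_quiver n) V"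
    and bars: "\<And>u v. (u, v) \<in> B \<Longrightarrow> u \<le> v \<and> v < n \<and> d u v > 0"
    and linear: "\<And>x. x < n \<Longrightarrow> linear_map K (vspace V x) (vspace (interval_sum K B d) x) (\<phi> x)"
    and bij: "\<And>x. x < n \<Longrightarrow>
      bij_betw (\<phi> x) (carrier (vspace V x)) (carrier (vspace (interval_sum K B d) x))"
    and commutes: "\<And>e a. 1 \<le> e \<Longrightarrow> e < n \<Longrightarrow> a \<in> carrier (vspace V (e - 1)) \<Longrightarrow>
      \<phi> e (emap V e a) = emap (interval_sum K B d) e (\<phi> (e - 1) a)"
begin

sublocale findim_representation K "A_quiver n" V
  by unfold_locales (auto simp: findim_A)

abbreviation "summand \<equiv> isotypic K d"
abbreviation "zero_at \<equiv> isotypic_zero K d"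

lemma ring_K: "ring K"
  using field by (simp add: field_def domain_def cring_def)

lemmas zero_at_ops [simp] = isotypic_zero_ops[OF ring_K, where d = d]

text \<open>The part of \<open>V\<close> that corresponds to the bars in \<open>S\<close>, carried back to \<open>V\<close> along \<open>\<phi>\<close>.\<close>

definition supported :: "(nat \<times> nat) set \<Rightarrow> nat \<Rightarrow> 'b set" where
  "supported S x = {a \<in> carrier (vspace V x). \<forall>p\<in>B - S. \<phi> x a p = zero_at p}"

lemma coords:
  assumes x: "x < n" and a: "a \<in> carrier (vspace V x)"
  shows "p \<in> B \<Longrightarrow> \<phi> x a p \<in> carrier (vspace (summand p) x)"
    and "p \<notin> B \<Longrightarrow> \<phi> x a p = undefined"
    and "b \<in> carrier (vspace V x) \<Longrightarrow> p \<in> B \<Longrightarrow>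
      \<phi> x (a \<oplus>\<^bsub>vspace V x\<^esub> b) p = \<phi> x a p \<oplus>\<^bsub>vspace (summand p) x\<^esub> \<phi> x b p"
    and "c \<in> carrier K \<Longrightarrow> p \<in> B \<Longrightarrow> \<phi> x (c \<odot>\<^bsub>vspace V x\<^esub> a) p = c \<odot>\<^bsub>vspace (summand p) x\<^esub> \<phi> x a p"
proof -
  note L = linear_map_simps[OF linear[OF x]]
  have mem: "\<phi> x a \<in> (\<Pi>\<^sub>E p\<in>B. carrier (vspace (summand p) x))" using L(1)[OF a] by simp
  show "p \<in> B \<Longrightarrow> \<phi> x a p \<in> carrier (vspace (summand p) x)" by (rule PiE_mem[OF mem])
  show "p \<notin> B \<Longrightarrow> \<phi> x a p = undefined" by (rule PiE_arb[OF mem])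
qed (use linear_map_simps(2,3)[OF linear[OF x]] a in simp_all)

lemma coords_zero: "x < n \<Longrightarrow> p \<in> B \<Longrightarrow> \<phi> x \<zero>\<^bsub>vspace V x\<^esub> p = zero_at p"
  using linear_map_simps(4)[OF linear] by simp

lemma coords_edge:
  assumes "1 \<le> e" "e < n" "a \<in> carrier (vspace V (e - 1))" "p \<in> B"
  shows "\<phi> e (emap V e a) p = emap (summand p) e (\<phi> (e - 1) a p)"
  using commutes[OF assms(1-3)] assms(4) by simp

lemma subrep_supported: "subrep K (A_quiver n) (supported S) V"
  unfolding subrep_def
proof (intro conjI ballI)
  fix x assume "x \<in> verts (A_quiver n)"
  then have x: "x < n" by simp
  have V: "vectorspace K (vspace V x)" using vertex_space(1)[of x] x by simp
  interpret V: vectorspace K "vspace V x" by (rule V)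
  show "VectorSpace.subspace K (supported S x) (vspace V x)"
    unfolding subspace_iff[OF V] supported_def using coords[OF x] coords_zero[OF x] by auto
next
  fix e assume "e \<in> arcs (A_quiver n)"
  then have e: "1 \<le> e" "e < n" by simp_all
  show "emap V e ` supported S (tail (A_quiver n) e) \<subseteq> supported S (head (A_quiver n) e)"
  proof (rule image_subsetI)
    fix a assume "a \<in> supported S (tail (A_quiver n) e)"
    then have a: "a \<in> carrier (vspace V (e - 1))" "\<forall>p\<in>B - S. \<phi> (e - 1) a p = zero_at p"
      by (auto simp: supported_def)
    have "emap V e a \<in> carrier (vspace V e)"
      using linear_map_simps(1)[OF edge_linear[of e]] e a by simp
    then show "emap V e a \<in> supported S (head (A_quiver n) e)"
      using a coords_edge[OF e a(1)] by (simp add: supported_def)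
  qed
qed

lemma supported_mono: "N \<subseteq> S \<Longrightarrow> supported N x \<subseteq> supported S x"
  by (auto simp: supported_def)

lemma supported_all: "supported B x = carrier (vspace V x)"
  by (auto simp: supported_def)

lemma supported_empty:
  assumes x: "x < n"
  shows "supported {} x = {\<zero>\<^bsub>vspace V x\<^esub>}"
proof -
  interpret V: vectorspace K "vspace V x" using vertex_space(1)[of x] x by simp
  have "a = \<zero>\<^bsub>vspace V x\<^esub>" if "a \<in> supported {} x" for a
  proof -
    have a: "a \<in> carrier (vspace V x)" "\<forall>p\<in>B. \<phi> x a p = zero_at p"
      using that by (auto simp: supported_def)
    have "\<phi> x a p = \<phi> x \<zero>\<^bsub>vspace V x\<^esub> p" for p
      using coords(2)[OF x] coords_zero[OF x] a V.M.zero_closed by (cases "p \<in> B") auto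
    then have "\<phi> x a = \<phi> x \<zero>\<^bsub>vspace V x\<^esub>" by (rule ext)
    then show ?thesis using inj_onD[OF bij_betw_imp_inj_on[OF bij[OF x]]] a by simp
  qed
  moreover have "\<zero>\<^bsub>vspace V x\<^esub> \<in> supported {} x"
    using coords_zero[OF x] by (auto simp: supported_def)
  ultimately show ?thesis by blast
qed

lemma supported_lift:
  assumes x: "x < n" and T: "T \<subseteq> S" "T \<subseteq> B" and w: "\<And>p. p \<in> T \<Longrightarrow> w p \<in> carrier (vspace (summand p) x)"
  shows "\<exists>a\<in>supported S x. \<forall>p\<in>T. \<phi> x a p = w p"
proof -
  let ?b = "\<lambda>p\<in>B. if p \<in> T then w p else zero_at p"
  have "?b \<in> carrier (vspace (interval_sum K B d) x)" using w by auto
  then have "?b \<in> \<phi> x ` carrier (vspace V x)"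
    using bij[OF x] by (simp only: bij_betw_def)
  then obtain a where a: "a \<in> carrier (vspace V x)" "\<phi> x a = ?b" by auto
  then have "a \<in> supported S x" "\<forall>p\<in>T. \<phi> x a p = w p" using T by (auto simp: supported_def)
  then show ?thesis by blast
qed

text \<open>
  A bar \<open>p = [u, v]\<close> in \<open>S - N\<close> is detected at the vertex \<open>u\<close> by a vector whose \<open>p\<close>-component has all
  entries equal to \<open>1\<close>; it is nonzero because multiplicities are positive.
\<close>

lemma supported_strict:
  assumes "N \<subseteq> S" "p \<in> S - N" "p \<in> B"
  shows "\<exists>x\<in>verts (A_quiver n). supported N x \<noteq> supported S x"
proof -
  obtain u v where p: "p = (u, v)" by (cases p)
  with bars assms have uv: "u \<le> v" "v < n" "d u v > 0" by auto
  interpret K: field K by (rule field)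
  have "(\<lambda>m\<in>{0..<d u v}. \<one>\<^bsub>K\<^esub>) \<in> carrier (vspace (summand p) u)"
    using uv by (simp add: p carrier_isotypic)
  then obtain a where a: "a \<in> supported S u" "\<phi> u a p = (\<lambda>m\<in>{0..<d u v}. \<one>\<^bsub>K\<^esub>)"
    using supported_lift[of u "{p}" S "\<lambda>_. \<lambda>m\<in>{0..<d u v}. \<one>\<^bsub>K\<^esub>"] uv assms by auto
  have "(\<lambda>m\<in>{0..<d u v}. \<one>\<^bsub>K\<^esub>) 0 \<noteq> zero_at p 0" using uv by (simp add: p isotypic_zero_def)
  then have "\<phi> u a p \<noteq> zero_at p" using a(2) by metis
  then have "a \<notin> supported N u" using assms by (auto simp: supported_def)
  with a uv show ?thesis by (intro bexI[of _ u]) auto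
qed

text \<open>The isomorphism forgets all components outside \<open>S - N\<close>.\<close>

lemma supported_quotient_iso_sum:
  assumes "N \<subseteq> S" "S \<subseteq> B"
  shows "rep_iso K (A_quiver n) (quot_rep (A_quiver n) (restrict_rep V (supported S)) (supported N))
    (interval_sum K (S - N) d)"
proof (rule subquotient_iso[where g = "\<lambda>x a. restrict (\<phi> x a) (S - N)"])
  have carr: "a \<in> carrier (vspace V x)" if "a \<in> supported S x" for a x
    using that by (simp add: supported_def)
  fix x assume "x \<in> verts (A_quiver n)"
  then have x: "x < n" by simp
  show "(\<lambda>a. restrict (\<phi> x a) (S - N)) ` supported S x =
      carrier (vspace (interval_sum K (S - N) d) x)"
  proof
    show "(\<lambda>a. restrict (\<phi> x a) (S - N)) ` supported S x \<subseteq>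
        carrier (vspace (interval_sum K (S - N) d) x)"
      using coords(1)[OF x carr] assms by auto
    show "carrier (vspace (interval_sum K (S - N) d) x) \<subseteq>
        (\<lambda>a. restrict (\<phi> x a) (S - N)) ` supported S x"
    proof
      fix w assume w: "w \<in> carrier (vspace (interval_sum K (S - N) d) x)"
      then have mem: "\<And>p. p \<in> S - N \<Longrightarrow> w p \<in> carrier (vspace (summand p) x)"
        and ext: "w \<in> extensional (S - N)" by (auto simp: PiE_iff)
      obtain a where a: "a \<in> supported S x" "\<forall>p\<in>S - N. \<phi> x a p = w p"
        using supported_lift[OF x, of "S - N" S w] assms mem by blast
      have "restrict (\<phi> x a) (S - N) = w"
        using a(2) ext by (auto simp: fun_eq_iff extensional_def)
      then show "w \<in> (\<lambda>a. restrict (\<phi> x a) (S - N)) ` supported S x" using a(1) by blast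
    qed
  qed
  fix a assume a: "a \<in> supported S x"
  show "restrict (\<phi> x a) (S - N) = \<zero>\<^bsub>vspace (interval_sum K (S - N) d) x\<^esub> \<longleftrightarrow> a \<in> supported N x"
  proof -
    have "restrict (\<phi> x a) (S - N) = (\<lambda>p\<in>S - N. zero_at p) \<longleftrightarrow> (\<forall>p\<in>S - N. \<phi> x a p = zero_at p)"
      by (auto simp: fun_eq_iff)
    also have "\<dots> \<longleftrightarrow> a \<in> supported N x" using a assms by (auto simp: supported_def)
    finally show ?thesis by simp
  qed
  show "restrict (\<phi> x (c \<odot>\<^bsub>vspace V x\<^esub> a)) (S - N) =
      c \<odot>\<^bsub>vspace (interval_sum K (S - N) d) x\<^esub> restrict (\<phi> x a) (S - N)"
    if "c \<in> carrier K" for c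
    using coords(4)[OF x carr[OF a] that] assms by (auto intro!: restrict_ext)
  fix b assume b: "b \<in> supported S x"
  show "restrict (\<phi> x (a \<oplus>\<^bsub>vspace V x\<^esub> b)) (S - N) =
      restrict (\<phi> x a) (S - N) \<oplus>\<^bsub>vspace (interval_sum K (S - N) d) x\<^esub> restrict (\<phi> x b) (S - N)"
    using coords(3)[OF x carr[OF a] carr[OF b]] assms by (auto intro!: restrict_ext)
next
  fix e a assume "e \<in> arcs (A_quiver n)" and a: "a \<in> supported S (tail (A_quiver n) e)"
  then have e: "1 \<le> e" "e < n" by simp_all
  show "restrict (\<phi> (head (A_quiver n) e) (emap V e a)) (S - N) =
      emap (interval_sum K (S - N) d) e (restrict (\<phi> (tail (A_quiver n) e) a) (S - N))"
    using coords_edge[OF e] a assms by (auto simp: supported_def intro!: restrict_ext)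
qed (auto intro!: subrep_supported supported_mono[OF assms(1), THEN subsetD])

text \<open>
  When one bar is added, the target is the summand itself and not a direct sum with one term, so the
  isomorphism takes the component at \<open>p\<close>.
\<close>

lemma supported_quotient_iso_isotypic:
  assumes "N \<subseteq> S" "S \<subseteq> B" "S - N = {p}"
  shows "rep_iso K (A_quiver n) (quot_rep (A_quiver n) (restrict_rep V (supported S)) (supported N))
    (summand p)"
proof (rule subquotient_iso[where g = "\<lambda>x a. \<phi> x a p"])
  have carr: "a \<in> carrier (vspace V x)" if "a \<in> supported S x" for a x
    using that by (simp add: supported_def)
  have p: "p \<in> S" "p \<in> B" using assms by auto
  fix x assume "x \<in> verts (A_quiver n)"
  then have x: "x < n" by simp
  show "(\<lambda>a. \<phi> x a p) ` supported S x = carrier (vspace (summand p) x)"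
  proof
    show "(\<lambda>a. \<phi> x a p) ` supported S x \<subseteq> carrier (vspace (summand p) x)"
      using coords(1)[OF x carr p(2)] by auto
    show "carrier (vspace (summand p) x) \<subseteq> (\<lambda>a. \<phi> x a p) ` supported S x"
    proof
      fix w assume "w \<in> carrier (vspace (summand p) x)"
      then obtain a where "a \<in> supported S x" "\<phi> x a p = w"
        using supported_lift[OF x, of "{p}" S "\<lambda>_. w"] p by auto
      then show "w \<in> (\<lambda>a. \<phi> x a p) ` supported S x" by blast
    qed
  qed
  fix a assume a: "a \<in> supported S x"
  have "B - N = insert p (B - S)" using assms by auto
  then show "\<phi> x a p = \<zero>\<^bsub>vspace (summand p) x\<^esub> \<longleftrightarrow> a \<in> supported N x"
    using a by (auto simp: supported_def)
  show "\<phi> x (c \<odot>\<^bsub>vspace V x\<^esub> a) p = c \<odot>\<^bsub>vspace (summand p) x\<^esub> \<phi> x a p" if "c \<in> carrier K" for c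
    using coords(4)[OF x carr[OF a] that p(2)] .
  fix b assume b: "b \<in> supported S x"
  show "\<phi> x (a \<oplus>\<^bsub>vspace V x\<^esub> b) p = \<phi> x a p \<oplus>\<^bsub>vspace (summand p) x\<^esub> \<phi> x b p"
    using coords(3)[OF x carr[OF a] carr[OF b] p(2)] .
next
  fix e a assume "e \<in> arcs (A_quiver n)" and a: "a \<in> supported S (tail (A_quiver n) e)"
  then have e: "1 \<le> e" "e < n" by simp_all
  show "\<phi> (head (A_quiver n) e) (emap V e a) p = emap (summand p) e (\<phi> (tail (A_quiver n) e) a p)"
    using coords_edge[OF e, of a p] a assms(2,3) by (auto simp: supported_def)
qed (auto intro!: subrep_supported supported_mono[OF assms(1), THEN subsetD])

lemma weight_euler: "weight (euler_stability (A_quiver n)) U = real (sdim U 0)"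
proof -
  have "weight (euler_stability (A_quiver n)) U = (\<Sum>x\<in>{0..<n}. if x = 0 then real (sdim U x) else 0)"
    unfolding weight_def A_quiver_simps by (intro sum.cong) (auto simp: euler_stability_A_quiver)
  also have "\<dots> = real (sdim U 0)" using n_pos by (simp add: sum.delta)
  finally show ?thesis .
qed

text \<open>
  Let \<open>\<delta> x\<close> be the dimension at \<open>x\<close> of the piece of \<open>U\<close> in \<open>I[0, j]\<^sup>d\<close>. An edge map between vertices of
  \<open>[0, j]\<close> preserves the component at \<open>(0, j)\<close>, so it is injective on these pieces. Hence \<open>\<delta>\<close> does not
  decrease up to \<open>j\<close>, and the \<open>j + 1\<close> values \<open>\<delta> 0, \<dots>, \<delta> j\<close> add up to at least \<open>(j + 1) * \<delta> 0\<close>.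
\<close>

lemma isotypic_step_bound:
  assumes NS: "N \<subseteq> S" "S \<subseteq> B" "S - N = {(0, j)}" and U: "subrep K (A_quiver n) U V"
  shows "real (sdim (cap U (supported S)) 0) - real (sdim (cap U (supported N)) 0) \<le>
    1 / (real j + 1) * (total_dim (cap U (supported S)) - total_dim (cap U (supported N)))"
proof -
  let ?A = "cap U (supported S)" and ?N = "cap U (supported N)"
  have p: "(0, j) \<in> S" "(0, j) \<in> B" "(0, j) \<notin> N" using NS by auto
  then have j: "j < n" using bars by auto
  have A: "subrep K (A_quiver n) ?A V" and N: "subrep K (A_quiver n) ?N V"
    by (intro subrep_cap U subrep_supported)+
  have NA: "?N x \<subseteq> ?A x" for x using supported_mono[OF NS(1)] by blast
  define \<delta> where "\<delta> x = real (sdim ?A x) - real (sdim ?N x)" for x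
  have step: "\<delta> x \<le> \<delta> (Suc x)" if x: "Suc x \<le> j" for x
  proof -
    have e: "1 \<le> Suc x" "Suc x \<in> verts (A_quiver n)" "x \<in> verts (A_quiver n)" "Suc x \<in> arcs (A_quiver n)"
      and xn: "x < n" "Suc x < n" using x j by auto
    have lin: "linear_map K (vspace V x) (vspace V (Suc x)) (emap V (Suc x))"
      using edge_linear[OF e(4)] by simp
    have inj: "a \<in> ?N x" if a: "a \<in> ?A x" and im: "emap V (Suc x) a \<in> ?N (Suc x)" for a
    proof -
      have aV: "a \<in> carrier (vspace V x)" using a by (auto simp: supported_def)
      have "\<phi> x a (0, j) = emap (summand (0, j)) (Suc x) (\<phi> x a (0, j))"
        using emap_isotypic_inside[OF _ _ coords(1)[OF xn(1) aV p(2)], of "Suc x"] x by simp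
      also have "\<dots> = \<phi> (Suc x) (emap V (Suc x) a) (0, j)"
        using coords_edge[OF e(1) xn(2) _ p(2), of a] aV by simp
      also have "\<dots> = zero_at (0, j)" using im p by (auto simp: supported_def)
      finally have "\<phi> x a (0, j) = zero_at (0, j)" .
      moreover have "B - N = insert (0, j) (B - S)" using NS by auto
      ultimately show ?thesis using a by (auto simp: supported_def)
    qed
    have "sdim ?A x + sdim ?N (Suc x) \<le> sdim ?N x + sdim ?A (Suc x)"
    proof (rule codim_le_of_injective_mod[OF lin vertex_space(2)[OF e(3)] vertex_space(2)[OF e(2)]
          subrep_subspace[OF A e(3)] subrep_subspace[OF N e(3)] NA
          subrep_subspace[OF A e(2)] subrep_subspace[OF N e(2)] NA])
      show "emap V (Suc x) ` ?A x \<subseteq> ?A (Suc x)"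
        using subrep_edge[OF A e(4)] by auto
    qed (rule inj)
    then show ?thesis unfolding \<delta>_def by linarith
  qed
  have base: "\<delta> 0 \<le> \<delta> x" if "x \<le> j" for x
    using that
  proof (induction x)
    case (Suc x)
    then show ?case using step[of x] by linarith
  qed simp
  have nonneg: "0 \<le> \<delta> x" if "x < n" for x
    unfolding \<delta>_def
    using subspace_dim_mono(1)[OF vertex_space subrep_subspace[OF N] subrep_subspace[OF A] NA, of x] that
    by simp
  have "(real j + 1) * \<delta> 0 = (\<Sum>x\<in>{0..<Suc j}. \<delta> 0)" by simp
  also have "\<dots> \<le> (\<Sum>x\<in>{0..<Suc j}. \<delta> x)" by (rule sum_mono) (auto intro: base)
  also have "\<dots> \<le> (\<Sum>x\<in>{0..<n}. \<delta> x)" using j by (intro sum_mono2) (auto intro: nonneg)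
  also have "\<dots> = total_dim ?A - total_dim ?N"
    by (simp add: total_dim_def \<delta>_def sum_subtractf)
  finally show ?thesis unfolding \<delta>_def by (simp add: field_simps)
qed

text \<open>
  The whole step is isomorphic to \<open>I[0, j]\<^sup>d\<close>, whose dimension is the same at \<open>0, \<dots>, j\<close> and zero afterwards.
  Comparing the vertex spaces avoids computing that dimension.
\<close>

lemma isotypic_step_exact:
  assumes NS: "N \<subseteq> S" "S \<subseteq> B" "S - N = {(0, j)}"
  shows "real (sdim (supported S) 0) - real (sdim (supported N) 0) =
    1 / (real j + 1) * (total_dim (supported S) - total_dim (supported N))"
proof -
  have p: "(0, j) \<in> B" using NS by auto
  then have j: "j < n" using bars by auto
  let ?q = "quot_rep (A_quiver n) (restrict_rep V (supported S)) (supported N)"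
  define \<delta> where "\<delta> x = real (sdim (supported S) x) - real (sdim (supported N) x)" for x
  note iso = supported_quotient_iso_isotypic[OF NS]
  note sub = subrep_supported[of S] subrep_supported[of N] supported_mono[OF NS(1)]
  have dim: "\<delta> x = real (vectorspace.dim K (vspace (summand (0, j)) x))" if x: "x < n" for x
  proof -
    have xv: "x \<in> verts (A_quiver n)" using x by simp
    note c = coset_map_subquotient[OF sub xv]
    have "vectorspace.fin_dim K (vspace ?q x)"
      using linear_map.surj_fin_dim[OF c(1) subspace_finite_dim(1)[OF vertex_space[OF xv]
          subrep_subspace[OF sub(1) xv]]] c(2) by simp
    then show ?thesis
      using dim_subquotient[OF sub xv] rep_iso_dim_eq[OF iso xv] unfolding \<delta>_def by simp
  qed
  have inside: "\<delta> x = \<delta> 0" if "x \<le> j" for x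
    using that j dim[of x] dim[of 0] vspace_isotypic_in_interval[of x 0 j 0 K d] by simp
  have outside: "\<delta> x = 0" if "j < x" "x < n" for x
  proof -
    have "vectorspace K (vspace (summand (0, j)) x)"
    proof -
      have xv: "x \<in> verts (A_quiver n)" using that by simp
      obtain \<psi> where "linear_map K (vspace ?q x) (vspace (summand (0, j)) x) \<psi>"
        using iso xv unfolding rep_iso_def by blast
      then show ?thesis by (rule linear_map_simps(6))
    qed
    moreover have "(vspace (summand (0, j)) x)\<lparr>carrier := {\<zero>\<^bsub>vspace (summand (0, j)) x\<^esub>}\<rparr> = vspace (summand (0, j)) x"
      using carrier_isotypic_outside[of x 0 j K d] that by simp
    ultimately show ?thesis using dim_zero_space[of K "vspace (summand (0, j)) x"] dim that by simp
  qed
  have "total_dim (supported S) - total_dim (supported N) = (\<Sum>x\<in>{0..<n}. \<delta> x)"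
    by (simp add: total_dim_def \<delta>_def sum_subtractf)
  also have "\<dots> = (\<Sum>x\<in>{0..<Suc j}. \<delta> 0)"
    using j by (intro sum.mono_neutral_cong_right) (auto intro: inside outside)
  also have "\<dots> = (real j + 1) * \<delta> 0" by simp
  finally show ?thesis unfolding \<delta>_def by (simp add: field_simps)
qed

text \<open>Bars that do not start at \<open>0\<close> contribute nothing at the vertex \<open>0\<close>, which is the only one with weight.\<close>

lemma supported_0_cong:
  assumes "N \<subseteq> S" "\<And>v. (0, v) \<in> S \<Longrightarrow> (0, v) \<in> N"
  shows "supported S 0 = supported N 0"
proof
  show "supported S 0 \<subseteq> supported N 0"
  proof
    fix a assume a: "a \<in> supported S 0"
    have "\<phi> 0 a p = zero_at p" if p: "p \<in> B - N" for p
    proof (cases "p \<in> S")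
      case True
      then obtain u v where uv: "p = (u, v)" "u \<noteq> 0" using assms p by (cases p) auto
      have "\<phi> 0 a p \<in> carrier (vspace (summand p) 0)"
        using coords(1)[of 0 a p] n_pos a p by (auto simp: supported_def)
      then show ?thesis using carrier_isotypic_outside[of 0 u v K d] uv by simp
    qed (use a p in \<open>auto simp: supported_def\<close>)
    then show "a \<in> supported N 0" using a by (auto simp: supported_def)
  qed
qed (rule supported_mono[OF assms(1)])

definition ends_from_0 :: "nat set" where
  "ends_from_0 = {j. (0, j) \<in> B}"

text \<open>
  The bars from \<open>0\<close> are added one by one, the shortest first, since a shorter bar has a larger slope. The last
  step adds all remaining bars.
\<close>

definition bar_chain :: "nat \<Rightarrow> (nat \<times> nat) set" where
  "bar_chain k = (if k \<le> card ends_from_0 then (\<lambda>i. (0, sorted_list_of_set ends_from_0 ! i)) ` {..<k} else B)"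

abbreviation "late_bars \<equiv> {(u, v) \<in> B. u \<noteq> 0}"

text \<open>If all bars start at \<open>0\<close>, then the last step would add nothing and is left out.\<close>

definition chain_length :: nat where
  "chain_length = (if late_bars = {} then card ends_from_0 else Suc (card ends_from_0))"

lemma finite_ends_from_0: "finite ends_from_0"
  by (rule finite_subset[of _ "{..<n}"]) (use bars in \<open>auto simp: ends_from_0_def\<close>)

lemmas ends_sorted = sorted_list_of_set_nth[OF finite_ends_from_0]

lemma bar_chain_subset: "bar_chain k \<subseteq> B"
  using ends_sorted(1,2) nth_mem[of _ "sorted_list_of_set ends_from_0"] by (auto simp: bar_chain_def ends_from_0_def)

lemma bar_chain_from_0: "bar_chain (card ends_from_0) = {0} \<times> ends_from_0"
proof -
  have "ends_from_0 = (!) (sorted_list_of_set ends_from_0) ` {..<card ends_from_0}"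
    using ends_sorted(1,2) nth_image[of "card ends_from_0" "sorted_list_of_set ends_from_0"]
    by (simp add: atLeast0LessThan)
  then show ?thesis unfolding bar_chain_def by auto
qed

lemma bar_chain_step:
  assumes "k < card ends_from_0"
  shows "bar_chain k \<subseteq> bar_chain (Suc k)"
    and "bar_chain (Suc k) - bar_chain k = {(0, sorted_list_of_set ends_from_0 ! k)}"
proof -
  have "sorted_list_of_set ends_from_0 ! i \<noteq> sorted_list_of_set ends_from_0 ! k"
      "sorted_list_of_set ends_from_0 ! k \<noteq> sorted_list_of_set ends_from_0 ! i" if "i < k" for i
    using ends_sorted(3)[OF that assms] by simp_all
  then show "bar_chain k \<subseteq> bar_chain (Suc k)"
    "bar_chain (Suc k) - bar_chain k = {(0, sorted_list_of_set ends_from_0 ! k)}"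
    using assms by (auto simp: bar_chain_def lessThan_Suc)
qed

lemma bar_chain_last:
  shows "bar_chain (card ends_from_0) \<subseteq> bar_chain (Suc (card ends_from_0))"
    and "bar_chain (Suc (card ends_from_0)) - bar_chain (card ends_from_0) = late_bars"
proof -
  have "bar_chain (Suc (card ends_from_0)) = B" by (simp add: bar_chain_def)
  then show "bar_chain (card ends_from_0) \<subseteq> bar_chain (Suc (card ends_from_0))"
    "bar_chain (Suc (card ends_from_0)) - bar_chain (card ends_from_0) = late_bars"
    unfolding bar_chain_from_0 by (auto simp: ends_from_0_def intro: gr0I)
qed

lemma bar_chain_full: "bar_chain chain_length = B"
proof (cases "late_bars = {}")
  case True
  then have "u = 0" if "(u, v) \<in> B" for u v using that by blast
  then have "B = {0} \<times> ends_from_0" by (fastforce simp: ends_from_0_def)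
  with True show ?thesis using bar_chain_from_0 by (simp add: chain_length_def)
next
  case False
  show ?thesis unfolding chain_length_def if_not_P[OF False] by (simp add: bar_chain_def)
qed

lemma bar_chain_increasing:
  assumes "k < chain_length"
  shows "bar_chain k \<subseteq> bar_chain (Suc k)" and "bar_chain (Suc k) - bar_chain k \<noteq> {}"
proof -
  have "k < card ends_from_0 \<or> k = card ends_from_0 \<and> late_bars \<noteq> {}"
    using assms by (auto simp: chain_length_def split: if_splits)
  then show "bar_chain k \<subseteq> bar_chain (Suc k)" "bar_chain (Suc k) - bar_chain k \<noteq> {}"
    using bar_chain_step bar_chain_last by (metis insert_not_empty)+
qed

definition bar_slope :: "nat \<Rightarrow> real" where
  "bar_slope k = (if k < card ends_from_0 then 1 / (real (sorted_list_of_set ends_from_0 ! k) + 1) else 0)"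

text \<open>
  For a step that adds one bar from \<open>0\<close>, the bound and the equality are those computed above. The step that
  adds the remaining bars changes nothing at the vertex \<open>0\<close>, so both of its weight differences vanish, and
  it has slope \<open>0\<close>.
\<close>

theorem barcode_slope_filtration:
  "slope_filtration (euler_stability (A_quiver n)) chain_length bar_slope (\<lambda>k. supported (bar_chain k))"
  unfolding slope_filtration_def weight_euler
proof (intro conjI allI impI)
  show "\<forall>x\<in>verts (A_quiver n). supported (bar_chain 0) x = {\<zero>\<^bsub>vspace V x\<^esub>} \<and>
      supported (bar_chain chain_length) x = carrier (vspace V x)"
    using supported_empty supported_all by (simp add: bar_chain_full) (simp add: bar_chain_def)
  show "bar_slope (Suc k) < bar_slope k" if "Suc k < chain_length" for k
  proof (cases "Suc k < card ends_from_0")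
    case True
    then show ?thesis using ends_sorted(3)[of k "Suc k"] by (simp add: bar_slope_def frac_less2)
  next
    case False
    then have "Suc k = card ends_from_0" using that by (auto simp: chain_length_def split: if_splits)
    then have "k < card ends_from_0" by simp
    with False show ?thesis by (simp add: bar_slope_def)
  qed
  fix k assume k: "k < chain_length"
  note inc = bar_chain_increasing[OF k]
  show "\<forall>x\<in>verts (A_quiver n). supported (bar_chain k) x \<subseteq> supported (bar_chain (Suc k)) x"
    using supported_mono[OF inc(1)] by blast
  show "\<exists>x\<in>verts (A_quiver n). supported (bar_chain k) x \<noteq> supported (bar_chain (Suc k)) x"
    using supported_strict[OF inc(1)] inc(2) bar_chain_subset by blast
  have last: "supported (bar_chain (Suc k)) 0 = supported (bar_chain k) 0" if "\<not> k < card ends_from_0"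
  proof -
    have "k = card ends_from_0" using that k by (auto simp: chain_length_def split: if_splits)
    then show ?thesis using bar_chain_last(2) by (intro supported_0_cong inc(1)) auto
  qed
  show "real (sdim (supported (bar_chain (Suc k))) 0) - real (sdim (supported (bar_chain k)) 0) =
      bar_slope k * (total_dim (supported (bar_chain (Suc k))) - total_dim (supported (bar_chain k)))"
    using isotypic_step_exact[OF inc(1) bar_chain_subset bar_chain_step(2)] last
    by (cases "k < card ends_from_0") (auto simp: bar_slope_def)
  fix U assume U: "subrep K (A_quiver n) U V"
  show "real (sdim (cap U (supported (bar_chain (Suc k)))) 0) - real (sdim (cap U (supported (bar_chain k))) 0)
      \<le> bar_slope k * (total_dim (cap U (supported (bar_chain (Suc k)))) -
          total_dim (cap U (supported (bar_chain k))))"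
    using isotypic_step_bound[OF inc(1) bar_chain_subset bar_chain_step(2) U] last
    by (cases "k < card ends_from_0") (auto simp: bar_slope_def)
qed (rule subrep_supported)

end

theorem theorem5p4:
  fixes K :: "('k, 'm) ring_scheme"
    and n l :: nat
    and V :: "(nat, nat, 'k, 'b) quiver_rep"
    and B J' :: "(nat \<times> nat) set"
    and d :: "nat \<Rightarrow> nat \<Rightarrow> nat"
    and J :: "nat set"
    and F :: "nat \<Rightarrow> nat \<Rightarrow> 'b set"
  assumes "field K"
    and "n \<ge> 1"
    and "findim_rep K (A_quiver n) V"
    and "nonzero_rep (A_quiver n) V"
    and "barcode_decomposition K n V B d"
    and "J = {j \<in> {0..n - 1}. (0, j) \<in> B}"
    and "J' = {(u, v) \<in> B. u \<noteq> 0}"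
    and "hn_filtration K (A_quiver n) (euler_stability (A_quiver n)) V l F"
  shows "(J' \<noteq> {} \<longrightarrow>
            l = 1 + card J \<and>
            (\<forall>k\<in>{1..<l}. let j = sorted_list_of_set J ! (k - 1) in
               rep_iso K (A_quiver n) (filt_quot (A_quiver n) V F k)
                 (pow_rep (interval_rep K 0 j) (d 0 j))) \<and>
            rep_iso K (A_quiver n) (filt_quot (A_quiver n) V F l) (interval_sum K J' d)) \<and>
         (J' = {} \<longrightarrow>
            l = card J \<and>
            (\<forall>k\<in>{1..l}. let j = sorted_list_of_set J ! (k - 1) in
               rep_iso K (A_quiver n) (filt_quot (A_quiver n) V F k)
                 (pow_rep (interval_rep K 0 j) (d 0 j))))"
proof -
  obtain \<phi> where \<phi>: "\<forall>x\<in>verts (A_quiver n).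
        linear_map K (vspace V x) (vspace (interval_sum K B d) x) (\<phi> x) \<and>
        bij_betw (\<phi> x) (carrier (vspace V x)) (carrier (vspace (interval_sum K B d) x))"
      "\<forall>e\<in>arcs (A_quiver n). \<forall>a\<in>carrier (vspace V (tail (A_quiver n) e)).
        \<phi> (head (A_quiver n) e) (emap V e a) =
        emap (interval_sum K B d) e (\<phi> (tail (A_quiver n) e) a)"
    using assms(5) unfolding barcode_decomposition_def rep_iso_def by blast
  have bounds: "u \<le> v \<and> v \<le> n - 1 \<and> d u v > 0" if "(u, v) \<in> B" for u v
    using assms(5) that unfolding barcode_decomposition_def by blast
  interpret barcode_representation K n V B d \<phi>
  proof (rule barcode_representation.intro)
    show "u \<le> v \<and> v < n \<and> d u v > 0" if "(u, v) \<in> B" for u v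
      using bounds[OF that] assms(2) by auto
    show "linear_map K (vspace V x) (vspace (interval_sum K B d) x) (\<phi> x)"
      "bij_betw (\<phi> x) (carrier (vspace V x)) (carrier (vspace (interval_sum K B d) x))" if "x < n" for x
      using \<phi>(1) that by simp_all
    show "\<phi> e (emap V e a) = emap (interval_sum K B d) e (\<phi> (e - 1) a)"
      if "1 \<le> e" "e < n" "a \<in> carrier (vspace V (e - 1))" for e a
      using \<phi>(2) that by simp
  qed (rule assms)+
  have J: "J = ends_from_0" using bounds by (auto simp: assms(6) ends_from_0_def)
  note unique = slope_filtration_unique[OF hn_filtration_imp_slope_filtration[OF assms(8)]
      barcode_slope_filtration]
  have l: "l = chain_length" by (rule unique(1))
  let ?G = "\<lambda>k. supported (bar_chain k)"
  \<comment> \<open>At the vertices, \<open>F\<close> and the bar chain have the same terms, hence the same quotients.\<close>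
  have transfer: "rep_iso K (A_quiver n) (filt_quot (A_quiver n) V F (Suc k)) W"
    if k: "Suc k \<le> l"
      and iso: "rep_iso K (A_quiver n) (quot_rep (A_quiver n) (restrict_rep V (?G (Suc k))) (?G k)) W"
    for k and W :: "(nat, nat, 'k, 'c) quiver_rep"
  proof (rule filt_quot_cong_iso[where G = ?G])
    show "rep_iso K (A_quiver n) (filt_quot (A_quiver n) V ?G (Suc k)) W"
      using iso by (simp add: filt_quot_def)
  qed (use unique(2) k in auto)
  have early: "let j = sorted_list_of_set J ! (k - 1) in
      rep_iso K (A_quiver n) (filt_quot (A_quiver n) V F k) (pow_rep (interval_rep K 0 j) (d 0 j))"
    if k: "1 \<le> k" "k \<le> card J" for k
  proof -
    obtain i where i: "k = Suc i" using k by (cases k) auto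
    then have iJ: "i < card ends_from_0" using k J by simp
    have "Suc i \<le> l" using iJ by (simp add: l chain_length_def)
    then show ?thesis
      using transfer[OF _ supported_quotient_iso_isotypic[OF bar_chain_step(1)[OF iJ] bar_chain_subset
            bar_chain_step(2)[OF iJ]]] i J
      by (simp add: isotypic_def)
  qed
  have late: "rep_iso K (A_quiver n) (filt_quot (A_quiver n) V F l) (interval_sum K J' d)"
    if "J' \<noteq> {}"
  proof -
    have "l = Suc (card ends_from_0)" using that by (simp add: l chain_length_def assms(7))
    then show ?thesis
      using transfer[OF _ supported_quotient_iso_sum[OF bar_chain_last(1) bar_chain_subset]]
      by (simp add: bar_chain_last(2) assms(7))
  qed
  show ?thesis
    using early late by (auto simp: l chain_length_def J assms(7))
qed

end
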